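(* Let $m,n\ge 1$ be integers and let $\mathcal{X}_n\subseteq M_n$ be any one of the following spaces: (i) $\mathcal{X}_n=M_n$, or the subspace of diagonalizable matrices in $M_n$; (ii) $\mathcal{X}_n=\mathrm{GL}(n)$, or the subspace of diagonalizable invertible matrices; (iii) $\mathcal{X}_n=\mathrm{SL}(n)$, or the subspace of diagonalizable matrices of determinant $1$; (iv) $\mathcal{X}_n=\mathrm{U}(n)$; (v) $\mathcal{X}_n=N_n$, the subspace of normal $n\times n$ matrices. Then there exists a continuous spectrum-shrinking map $\phi:\mathcal{X}_n\to M_m$ if and only if $n$ divides $m$. Moreover, in that case every continuous spectrum-shrinking map $\phi:\mathcal{X}_n\to M_m$ satisfies $k_{\phi(X)}=(k_X)^{m/n}$ for all $X\in\mathcal{X}_n$.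
   Context: $M_n$ is the algebra of $n\times n$ complex matrices with its usual topology; $\mathrm{GL}(n),\mathrm{SL}(n),\mathrm{U}(n)\subseteq M_n$ are the groups of invertible, determinant-$1$ and unitary complex matrices. All subsets carry the subspace topology. $\mathrm{sp}(X)$ is the spectrum (set of eigenvalues) of $X$, and $k_X(x)=\det(xI-X)$ is its characteristic polynomial. A map $\phi:\mathcal{X}_n\to M_m$ is spectrum-shrinking if $\mathrm{sp}(\phi(X))\subseteq\mathrm{sp}(X)$ for all $X\in\mathcal{X}_n$. *)

theory Defs
  imports "HOL-Analysis.Analysis" "HOL-Computational_Algebra.Polynomial"
begin

definition spectrum :: "complex^'k^'k \<Rightarrow> complex set" where
  "spectrum X = {c. \<exists>v. v \<noteq> 0 \<and> X *v v = c *s v}"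

(* det(xI - X), computed in the ring of complex polynomials *)
definition charpoly :: "complex^'k^'k \<Rightarrow> complex poly" where
  "charpoly X = det (mat [:0, 1:] - map_matrix (\<lambda>c. [:c:]) X)"

definition adjoint_matrix :: "complex^'k^'k \<Rightarrow> complex^'k^'k" where
  "adjoint_matrix X = map_matrix cnj (transpose X)"

definition unitary_matrix :: "complex^'k^'k \<Rightarrow> bool" where
  "unitary_matrix X \<longleftrightarrow> adjoint_matrix X ** X = mat 1 \<and> X ** adjoint_matrix X = mat 1"

definition normal_matrix :: "complex^'k^'k \<Rightarrow> bool" where
  "normal_matrix X \<longleftrightarrow> X ** adjoint_matrix X = adjoint_matrix X ** X"

definition diagonal_matrix :: "complex^'k^'k \<Rightarrow> bool" where
  "diagonal_matrix D \<longleftrightarrow> (\<forall>i j. i \<noteq> j \<longrightarrow> D $ i $ j = 0)"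

definition diagonalizable :: "complex^'k^'k \<Rightarrow> bool" where
  "diagonalizable X \<longleftrightarrow>
     (\<exists>(P :: complex^'k^'k) (D :: complex^'k^'k).
        invertible P \<and> diagonal_matrix D \<and> X = P ** D ** matrix_inv P)"

definition matrix_spaces :: "(complex^'k^'k) set set" where
  "matrix_spaces =
     {UNIV,
      {X. diagonalizable X},
      {X. invertible X},
      {X. diagonalizable X \<and> invertible X},
      {X. det X = 1},
      {X. diagonalizable X \<and> det X = 1},
      {X. unitary_matrix X},
      {X. normal_matrix X}}"

(* A map on the subset S is a total function whose values outside S are irrelevant. *)
definition spectrum_shrinking_on ::
    "(complex^'k^'k) set \<Rightarrow> (complex^'k^'k \<Rightarrow> complex^'l^'l) \<Rightarrow> bool" where
  "spectrum_shrinking_on S \<phi> \<longleftrightarrow> (\<forall>X\<in>S. spectrum (\<phi> X) \<subseteq> spectrum X)"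

end

theory Submission
  imports Defs "HOL-Computational_Algebra.Fundamental_Theorem_Algebra"
begin

text \<open>
  Let \<open>\<phi>\<close> be continuous and spectrum-shrinking. If the eigenvalues \<open>\<mu>\<^sub>k\<close> of \<open>X\<close> are distinct, then
  the characteristic polynomial of \<open>\<phi> X\<close> is the product of the \<open>(x - \<mu>\<^sub>k) ^ d\<^sub>k\<close> for unique
  exponents \<open>d\<^sub>k\<close> whose sum is \<open>m\<close>. The whole theorem is the assertion that the \<open>d\<^sub>k\<close> are equal.

  When \<open>X\<close> moves along a path on which its eigenvalues stay distinct, the exponents cannot jump,
  since they are integers (\<open>multiplicities_constant_along_path\<close>). Now move
  \<open>X = P diag(\<mu>) P\<inverse>\<close> around a loop that permutes its eigenvalues. First conjugate the diagonal
  part by unitary matrices leading from the identity to a permutation matrix: the spectrum does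
  not move at all, and the path ends at \<open>P diag(\<mu> \<circ> \<sigma>) P\<inverse>\<close>. Then carry the tuple \<open>\<mu> \<circ> \<sigma>\<close>
  back to \<open>\<mu>\<close> through tuples of distinct numbers. Both ends have the same \<open>\<phi> X\<close>, so \<open>d \<circ> \<sigma> = d\<close>
  (\<open>multiplicities_invariant_under_monodromy\<close>). It remains to provide enough loops inside each space.

  Outside the unitary group write \<open>\<mu>\<^sub>k = exp a\<^sub>k\<close> and let \<open>\<sigma>\<close> be a transposition. On the complex
  line through \<open>a\<close> and \<open>a \<circ> \<sigma>\<close> only countably many points give coinciding exponentials, and the
  plane remains path connected without them. The sum of the \<open>a\<^sub>k\<close> is constant on this line, so the
  determinant does not change and the loop also lies in the special linear group. Hence all \<open>d\<^sub>k\<close>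
  are equal. In the unitary group the eigenvalues cannot overtake each other on the circle. But
  the arguments in a fixed cyclic order form a convex set, which contains the tuple in which every
  eigenvalue has moved on to the place of its successor; so \<open>\<sigma>\<close> can be an \<open>n\<close>-cycle, and this
  suffices as well (\<open>charpoly_power_distinct_unit_circle\<close>).

  A general \<open>X\<close> is reached in three steps. Schur's theorem gives \<open>X = V (D + N) V*\<close> with \<open>D\<close> diagonal
  and \<open>N\<close> strictly triangular, and shrinking \<open>N\<close> to \<open>0\<close> leaves the spectrum fixed. Coinciding
  eigenvalues are separated by the factors \<open>exp (i t c\<^sub>k)\<close> with \<open>c\<^sub>k\<close> real and of sum \<open>0\<close>, which
  keeps determinants and unitarity, and then \<open>t\<close> tends to \<open>0\<close>
  (\<open>charpoly_power_exponentials\<close>). A singular \<open>X\<close> is the limit of the matrices \<open>X + t I\<close>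
  (\<open>charpoly_power_shift\<close>). Diagonalizable and normal matrices are written as \<open>P D P\<inverse>\<close> and
  \<open>V D V*\<close> instead, with \<open>N = 0\<close>, so that the paths stay in their space.

  Conversely, if \<open>n\<close> divides \<open>m\<close>, then placing \<open>m / n\<close> copies of \<open>X\<close> on the diagonal is a
  spectrum-shrinking map.
\<close>

section \<open>Characteristic polynomials and spectra\<close>

text \<open>
  The index type carries no order, so triangularity refers to an injective rank function \<open>r\<close>. A
  permutation that never lowers the rank preserves the sum of all ranks, hence every rank, and is
  therefore the identity: all other terms of the Leibniz formula vanish.
\<close>

lemma det_triangular:
  fixes A :: "'a::comm_ring_1^'n^'n" and r :: "'n \<Rightarrow> nat"
  assumes inj: "inj r" and tri: "\<And>i j. r j < r i \<Longrightarrow> A $ i $ j = 0"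
  shows "det A = (\<Prod>i\<in>UNIV. A $ i $ i)"
proof -
  have p0: "of_int (sign p) * (\<Prod>i\<in>UNIV. A $ i $ p i) = 0"
    if p: "p \<in> {p. p permutes UNIV} - {id}" for p
  proof -
    have "\<exists>i. r (p i) < r i"
    proof (rule ccontr)
      assume "\<nexists>i. r (p i) < r i"
      then have le: "r i \<le> r (p i)" for i by (simp add: not_less)
      have bij: "bij p" using p permutes_bij by blast
      have "(\<Sum>i\<in>UNIV. r (p i)) = (\<Sum>i\<in>UNIV. r i)"
        using bij sum.reindex_bij_betw by blast
      then have "r i = r (p i)" for i
        by (intro sum_mono_inv[of r UNIV "\<lambda>i. r (p i)"]) (simp_all add: le)
      then have "p = id" using inj by (auto simp: inj_def fun_eq_iff)
      with p show False by simp
    qed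
    then have "\<exists>i\<in>UNIV. A $ i $ p i = 0" using tri by blast
    then show ?thesis by (simp add: prod_zero)
  qed
  show ?thesis
    using sum.mono_neutral_cong_left[OF finite_permutations[OF finite], of "{id}" UNIV
        "\<lambda>p. of_int (sign p) * (\<Prod>i\<in>UNIV. A $ i $ p i)" "\<lambda>p. of_int (sign p) * (\<Prod>i\<in>UNIV. A $ i $ p i)"] p0
    unfolding det_def by (simp add: permutes_id)
qed

lemma poly_det:
  fixes A :: "'a::comm_ring_1 poly^'n^'n"
  shows "poly (det A) x = det (map_matrix (\<lambda>p. poly p x) A)"
  by (simp add: det_def poly_sum poly_prod map_matrix_def)

lemma poly_charpoly: "poly (charpoly X) x = det (mat x - X)"
  unfolding charpoly_def poly_det
  by (rule arg_cong[where f = det]) (simp add: vec_eq_iff mat_def)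

text \<open>
  This connects eigenvectors, which define the spectrum, with roots, whose multiplicities are counted.
\<close>

lemma mem_spectrum_iff: "x \<in> spectrum X \<longleftrightarrow> poly (charpoly X) x = 0"
proof -
  have eq: "(mat x - X) *v v = x *s v - X *v v" for v
  proof -
    have "mat x *v v = x *s v"
      by (simp add: vec_eq_iff matrix_vector_mult_def mat_def
          if_distrib [where f = "\<lambda>c. c * _"] cong: if_cong)
    then show ?thesis by (simp add: matrix_vector_mult_diff_rdistrib)
  qed
  have "x \<in> spectrum X \<longleftrightarrow> \<not> (\<forall>v. (mat x - X) *v v = 0 \<longrightarrow> v = 0)"
    unfolding spectrum_def eq by (simp add: eq_commute[of _ "X *v _"]) (metis)
  also have "\<dots> \<longleftrightarrow> det (mat x - X) = 0"
    by (simp only: matrix_left_invertible_ker[symmetric] invertible_left_inverse[symmetric]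
        invertible_det_nz not_not)
  finally show ?thesis by (simp add: poly_charpoly)
qed

lemma continuous_on_matrix_mult [continuous_intros]:
  fixes f :: "'b::topological_space \<Rightarrow> 'a::real_normed_field^'n^'m" and g :: "'b \<Rightarrow> 'a^'k^'n"
  assumes "continuous_on T f" "continuous_on T g"
  shows "continuous_on T (\<lambda>x. f x ** g x)"
  unfolding matrix_matrix_mult_def by (intro continuous_intros assms)

lemma continuous_on_det [continuous_intros]:
  fixes f :: "'b::topological_space \<Rightarrow> 'a::real_normed_field^'n^'n"
  assumes "continuous_on T f"
  shows "continuous_on T (\<lambda>x. det (f x))"
  unfolding det_def by (intro continuous_intros assms)

lemma det_scale:
  fixes A :: "'a::comm_ring_1^'n^'n"
  shows "det (\<chi> i j. c * A $ i $ j) = c ^ CARD('n) * det A"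
  using det_rows_mul[of "\<lambda>_. c" "\<lambda>i. A $ i"]
  by (simp add: vector_scalar_mult_def)

text \<open>
  For large \<open>x\<close> the matrix \<open>I - X / x\<close> is close to \<open>I\<close>, so that \<open>det (x I - X) / x ^ n\<close> tends to \<open>1\<close>.
  Degree and leading coefficient of a polynomial can be read off from its growth.
\<close>

lemma
  fixes X :: "complex^'n^'n"
  shows lead_coeff_charpoly: "lead_coeff (charpoly X) = 1"
    and degree_charpoly: "degree (charpoly X) = CARD('n)"
proof -
  define p where "p = charpoly X"
  define B where "B s = mat 1 - (\<chi> i j. s * X $ i $ j)" for s
  have Bcont: "continuous_on UNIV (\<lambda>s. det (B s))"
    unfolding B_def by (intro continuous_intros)
  have "isCont (\<lambda>s. det (B s)) 0"
    using Bcont continuous_on_eq_continuous_at open_UNIV by blast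
  then have "((\<lambda>s. det (B s)) \<longlongrightarrow> det (B 0)) (at 0)"
    by (simp add: isCont_def)
  moreover have "B 0 = mat 1" by (simp add: B_def vec_eq_iff)
  ultimately have "((\<lambda>s. det (B s)) \<longlongrightarrow> 1) (at 0)" by simp
  then have lim1: "((\<lambda>x. det (B (inverse x))) \<longlongrightarrow> 1) at_infinity"
    by (simp add: filterlim_at_infinity_imp_filterlim_at_top at_to_infinity filterlim_filtermap)
  have eq: "poly p x / x ^ CARD('n) = det (B (inverse x))" if "x \<noteq> 0" for x
  proof -
    have "mat x - X = (\<chi> i j. x * B (inverse x) $ i $ j)"
      using that by (simp add: B_def vec_eq_iff mat_def field_simps)
    then have "poly p x = x ^ CARD('n) * det (B (inverse x))"
      unfolding p_def poly_charpoly by (simp only: det_scale)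
    with that show ?thesis by simp
  qed
  have ev: "eventually (\<lambda>x::complex. x \<noteq> 0) at_infinity"
    by (rule eventually_not_equal_at_infinity)
  have lim2: "((\<lambda>x. poly p x / x ^ CARD('n)) \<longlongrightarrow> 1) at_infinity"
    by (rule Lim_transform_eventually[OF lim1]) (use ev in eventually_elim, simp add: eq)
  have lim3: "((\<lambda>x. poly p x / x ^ degree p) \<longlongrightarrow> lead_coeff p) at_infinity"
    by (rule poly_divide_tendsto_aux)
  have p0: "p \<noteq> 0"
  proof
    assume "p = 0"
    with lim2 have "((\<lambda>x::complex. 0::complex) \<longlongrightarrow> 1) at_infinity" by simp
    from tendsto_unique[OF trivial_limit_at_infinity this tendsto_const] show False by simp
  qed
  have deg: "degree p = CARD('n)"
  proof (rule linorder_cases[of "degree p" "CARD('n)"])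
    assume less: "degree p < CARD('n)"
    have "((\<lambda>x::complex. inverse (x ^ (CARD('n) - degree p))) \<longlongrightarrow> 0) at_infinity"
      using less by (intro tendsto_inverse_0[THEN filterlim_compose] filterlim_power_at_infinity filterlim_ident) auto
    from tendsto_mult[OF lim3 this]
    have "((\<lambda>x. poly p x / x ^ degree p * inverse (x ^ (CARD('n) - degree p))) \<longlongrightarrow> 0) at_infinity" by simp
    then have "((\<lambda>x. poly p x / x ^ CARD('n)) \<longlongrightarrow> 0) at_infinity"
      by (rule Lim_transform_eventually)
        (use ev in eventually_elim, use less in \<open>simp add: field_simps flip: power_add\<close>)
    then have "(1::complex) = 0"
      using lim2 tendsto_unique trivial_limit_at_infinity by blast
    then show ?thesis by simp
  next
    assume less: "CARD('n) < degree p"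
    have "((\<lambda>x::complex. inverse (x ^ (degree p - CARD('n)))) \<longlongrightarrow> 0) at_infinity"
      using less by (intro tendsto_inverse_0[THEN filterlim_compose] filterlim_power_at_infinity filterlim_ident) auto
    from tendsto_mult[OF lim2 this]
    have "((\<lambda>x. poly p x / x ^ CARD('n) * inverse (x ^ (degree p - CARD('n)))) \<longlongrightarrow> 0) at_infinity" by simp
    then have "((\<lambda>x. poly p x / x ^ degree p) \<longlongrightarrow> 0) at_infinity"
      by (rule Lim_transform_eventually)
        (use ev in eventually_elim, use less in \<open>simp add: field_simps flip: power_add\<close>)
    then have "lead_coeff p = 0"
      using lim3 tendsto_unique trivial_limit_at_infinity by blast
    with p0 show ?thesis by simp
  qed
  then show "degree (charpoly X) = CARD('n)" by (simp add: p_def)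
  have "lead_coeff p = 1"
    using lim2 lim3 tendsto_unique[OF trivial_limit_at_infinity] by (metis deg)
  then show "lead_coeff (charpoly X) = 1" by (simp add: p_def)
qed

text \<open>
  All perturbation arguments below use this form of density: the perturbed matrix is good except for
  countably many values of the parameter, and the conclusion is continuous in the parameter.
\<close>

lemma eq_at_0_if_eq_off_countable:
  fixes f g :: "real \<Rightarrow> 'a::real_normed_vector"
  assumes f: "continuous_on {0..1} f" and g: "continuous_on {0..1} g"
    and B: "countable B" and eq: "\<And>t. t \<in> {0<..<1} - B \<Longrightarrow> f t = g t"
  shows "f 0 = g 0"
proof (rule ccontr)
  assume ne: "f 0 \<noteq> g 0"
  have "continuous_on {0..1} (\<lambda>t. f t - g t)" using f g by (intro continuous_intros)
  then obtain d where d: "d > 0"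
      "\<And>t. t \<in> {0..1} \<Longrightarrow> dist t 0 < d \<Longrightarrow> dist (f t - g t) (f 0 - g 0) < norm (f 0 - g 0)"
    using ne unfolding continuous_on_iff by (metis atLeastAtMost_iff order_refl right_minus_eq zero_le_one zero_less_norm_iff)
  have "{0<..<min d 1} \<subseteq> B"
  proof
    fix t assume t: "t \<in> {0<..<min d 1}"
    show "t \<in> B"
    proof (rule ccontr)
      assume "t \<notin> B"
      with t eq have "f t = g t" by simp
      with d(2)[of t] t show False by (simp add: dist_norm norm_minus_commute)
    qed
  qed
  then have "countable {0<..<min d 1}" using B countable_subset by blast
  moreover have "uncountable {0<..<min d 1}" using d(1) by (simp add: uncountable_open_interval)
  ultimately show False by blast
qed

lemma ex_inj_nat:
  obtains r :: "'n::finite \<Rightarrow> nat" where "inj r"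
  using countable_finite[of "UNIV :: 'n set"] unfolding countable_def by auto

section \<open>Schur triangularization and the spectral theorem\<close>

definition cinner :: "complex^'n \<Rightarrow> complex^'n \<Rightarrow> complex" where
  "cinner u v = (\<Sum>i\<in>UNIV. cnj (u $ i) * v $ i)"

lemma cinner_add: "cinner u (v + w) = cinner u v + cinner u w"
  by (simp add: cinner_def algebra_simps sum.distrib)

lemma cinner_diff: "cinner u (v - w) = cinner u v - cinner u w"
  by (simp add: cinner_def algebra_simps sum_subtractf)

lemma cinner_scale: "cinner u (c *s v) = c * cinner u v"
  by (simp add: cinner_def algebra_simps sum_distrib_left)

lemma cinner_scale_left: "cinner (c *s u) v = cnj c * cinner u v"
  by (simp add: cinner_def algebra_simps sum_distrib_left)

lemma cinner_sum: "cinner u (\<Sum>l\<in>A. f l) = (\<Sum>l\<in>A. cinner u (f l))"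
  by (induction A rule: infinite_finite_induct) (simp_all add: cinner_add, simp_all add: cinner_def)

lemma cinner_commute: "cinner v u = cnj (cinner u v)"
  by (simp add: cinner_def mult.commute)

lemma cinner_self: "cinner u u = of_real ((norm u)\<^sup>2)"
  by (simp add: cinner_def norm_vec_def L2_set_def sum_nonneg complex_norm_square mult.commute
      del: of_real_power)

lemma kernel_vector_if_det_zero:
  fixes A :: "'a::field^'n^'n"
  assumes "det A = 0"
  obtains u where "u \<noteq> 0" "A *v u = 0"
proof -
  have "\<not> (\<exists>B. B ** A = mat 1)"
    using assms by (simp add: invertible_left_inverse[symmetric] invertible_det_nz)
  then have "\<exists>u. A *v u = 0 \<and> u \<noteq> 0" by (simp add: matrix_left_invertible_ker)
  with that show ?thesis by metis
qed

text \<open>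
  This is the existence of an eigenvector for the compression of \<open>X\<close> to the image of a projection
  \<open>\<rho>\<close>, stated without a matrix for the subspace. The pencil \<open>M x = I - \<rho> + \<rho> X \<rho> - x \<rho>\<close> is singular
  exactly at the eigenvalues of the compression. Were its determinant constant, then multiplying
  \<open>M (1 / s)\<close> by \<open>I - \<rho> + s \<rho>\<close> and letting \<open>s\<close> tend to \<open>0\<close> would show that a multiple of
  \<open>det (I - \<rho>) = 0\<close> equals \<open>det (I - 2 \<rho>)\<close>, which is not zero as \<open>I - 2 \<rho>\<close> is an involution.
\<close>

lemma compression_has_eigenvector:
  fixes X \<rho> :: "complex^'n^'n"
  assumes idem: "\<And>u. \<rho> *v (\<rho> *v u) = \<rho> *v u" and w: "\<rho> *v w \<noteq> 0"
  obtains u c where "u \<noteq> 0" "\<rho> *v u = u" "\<rho> *v (X *v u) = c *s u"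
proof -
  define A where "A = mat 1 - \<rho> + \<rho> ** X ** \<rho>"
  define M where "M x = A - (\<chi> i j. x * \<rho> $ i $ j)" for x
  define p where "p = det (map_matrix (\<lambda>c. [:c:]) A - map_matrix (\<lambda>c. [:0, c:]) \<rho>)"
  have smult: "(\<chi> i j. x * \<rho> $ i $ j) *v u = x *s (\<rho> *v u)" for x u
    by (simp add: vec_eq_iff matrix_vector_mult_def sum_distrib_left mult.assoc)
  have A: "A *v u = u - \<rho> *v u + \<rho> *v (X *v (\<rho> *v u))" for u
    by (simp add: A_def matrix_vector_mult_add_rdistrib matrix_vector_mult_diff_rdistrib
        matrix_vector_mul_assoc matrix_mul_assoc)
  have M: "M x *v u = u - \<rho> *v u + \<rho> *v (X *v (\<rho> *v u)) - x *s (\<rho> *v u)" for x u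
    by (simp add: M_def matrix_vector_mult_diff_rdistrib A smult)
  have poly_p: "poly p x = det (M x)" for x
    unfolding p_def poly_det M_def by (rule arg_cong[where f = det]) (simp add: vec_eq_iff)
  have "degree p > 0"
  proof (rule ccontr)
    assume "\<not> degree p > 0"
    then have const: "poly p x = poly p y" for x y by (auto elim!: degree_eq_zeroE)
    define P where "P s = mat 1 - \<rho> + (\<chi> i j. s * \<rho> $ i $ j)" for s
    define Q where "Q s = mat 1 - \<rho> - \<rho> + (\<chi> i j. s * (\<rho> ** X ** \<rho>) $ i $ j)" for s
    have P: "P s *v u = u - \<rho> *v u + s *s (\<rho> *v u)" for s u
      by (simp add: P_def matrix_vector_mult_add_rdistrib matrix_vector_mult_diff_rdistrib smult)
    have "(\<chi> i j. s * (\<rho> ** X ** \<rho>) $ i $ j) *v u = s *s (\<rho> *v (X *v (\<rho> *v u)))" for s u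
      by (simp add: matrix_vector_mul_assoc matrix_mul_assoc)
        (simp add: vec_eq_iff matrix_vector_mult_def sum_distrib_left mult.assoc)
    then have Q: "Q s *v u = u - \<rho> *v u - \<rho> *v u + s *s (\<rho> *v (X *v (\<rho> *v u)))" for s u
      by (simp only: Q_def matrix_vector_mult_add_rdistrib matrix_vector_mult_diff_rdistrib
          matrix_vector_mul_lid)
    have MP: "M (inverse s) ** P s = Q s" if "s \<noteq> 0" for s
    proof -
      have "(M (inverse s) ** P s) *v u = Q s *v u" for u
        using that by (simp add: matrix_vector_mul_assoc[symmetric] M P Q idem
            matrix_vector_right_distrib matrix_vector_mult_diff_distrib vector_scalar_commute)
      then show ?thesis using matrix_eq by blast
    qed
    have "poly p 0 * det (P (of_real 0)) = det (Q (of_real 0))"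
    proof (rule eq_at_0_if_eq_off_countable)
      show "continuous_on {0..1::real} (\<lambda>s. poly p 0 * det (P (of_real s)))"
        unfolding P_def by (intro continuous_intros)
      show "continuous_on {0..1::real} (\<lambda>s. det (Q (of_real s)))"
        unfolding Q_def by (intro continuous_intros)
      show "poly p 0 * det (P (of_real t)) = det (Q (of_real t))" if "t \<in> {0<..<1} - {}" for t
        using MP[of "of_real t"] that const[of 0 "inverse (of_real t)"]
        by (simp add: poly_p det_mul[symmetric])
    qed simp
    moreover have "det (P 0) = 0"
    proof -
      have "P 0 *v (\<rho> *v w) = 0" by (simp add: P idem)
      with w show ?thesis
        by (metis invertible_det_nz invertible_left_inverse matrix_left_invertible_ker)
    qed
    moreover have "det (Q 0) \<noteq> 0"
    proof -
      have Q0: "Q 0 *v u = u - \<rho> *v u - \<rho> *v u" for u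
        by (simp only: Q vector_smult_lzero add_0_right)
      have \<rho>Q: "\<rho> *v (Q 0 *v u) = - (\<rho> *v u)" for u
        by (simp only: Q0 matrix_vector_mult_diff_distrib idem) simp
      have "Q 0 *v (Q 0 *v u) = u" for u
        by (subst Q0) (simp only: \<rho>Q, simp add: Q0)
      then have "(Q 0 ** Q 0) *v u = mat 1 *v u" for u
        by (simp add: matrix_vector_mul_assoc[symmetric])
      then have "Q 0 ** Q 0 = mat 1" using matrix_eq by blast
      then have "det (Q 0) * det (Q 0) = 1" by (metis det_I det_mul)
      then show ?thesis by auto
    qed
    ultimately show False by simp
  qed
  then obtain x where "poly p x = 0" using alg_closed_imp_poly_has_root by blast
  then have "det (M x) = 0" by (simp add: poly_p)
  then obtain u where u: "u \<noteq> 0" "M x *v u = 0" by (rule kernel_vector_if_det_zero)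
  have eq: "u - \<rho> *v u + \<rho> *v (X *v (\<rho> *v u)) - x *s (\<rho> *v u) = 0" using u(2) by (simp add: M)
  then have "\<rho> *v (u - \<rho> *v u + \<rho> *v (X *v (\<rho> *v u)) - x *s (\<rho> *v u)) = 0" by simp
  then have eig: "\<rho> *v (X *v (\<rho> *v u)) = x *s (\<rho> *v u)"
    by (simp add: matrix_vector_right_distrib matrix_vector_mult_diff_distrib idem
        vector_scalar_commute)
  with eq have "\<rho> *v u = u" by simp
  with eig u(1) show ?thesis using that by metis
qed

text \<open>
  The induction extends the flag by an eigenvector of the compression of \<open>X\<close> to the orthogonal
  complement of the vectors found so far: \<open>X\<close> maps it to a multiple of itself plus a combination of
  those vectors.
\<close>

lemma orthonormal_flag:
  fixes X :: "complex^'n^'n"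
  assumes "k \<le> CARD('n)"
  shows "\<exists>v :: nat \<Rightarrow> complex^'n. (\<forall>i<k. \<forall>j<k. cinner (v i) (v j) = of_bool (i = j)) \<and>
           (\<forall>j<k. \<exists>c. X *v v j = (\<Sum>i\<le>j. c i *s v i))"
  using assms
proof (induction k)
  case (Suc k)
  then obtain v :: "nat \<Rightarrow> complex^'n" where
      on: "\<And>i j. i < k \<Longrightarrow> j < k \<Longrightarrow> cinner (v i) (v j) = of_bool (i = j)"
      and flag: "\<And>j. j < k \<Longrightarrow> \<exists>c. X *v v j = (\<Sum>i\<le>j. c i *s v i)"
    by auto
  define \<rho> :: "complex^'n^'n" where
    "\<rho> = mat 1 - (\<Sum>l<k. \<chi> i j. v l $ i * cnj (v l $ j))"
  have "(\<Sum>l<k. \<chi> i j. v l $ i * cnj (v l $ j)) *v u = (\<Sum>l<k. cinner (v l) u *s v l)" for u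
    by (simp add: vec_eq_iff matrix_vector_mult_def cinner_def sum_distrib_left sum_distrib_right
        mult.assoc mult.commute mult.left_commute)
      (intro allI sum.swap)
  then have \<rho>: "\<rho> *v u = u - (\<Sum>l<k. cinner (v l) u *s v l)" for u
    by (simp add: \<rho>_def matrix_vector_mult_diff_rdistrib)
  have orth: "cinner (v l) (\<rho> *v u) = 0" if "l < k" for l u
    using that by (simp add: \<rho> cinner_diff cinner_sum cinner_scale on of_bool_def
        if_distrib[where f = "\<lambda>x. _ * x"] cong: if_cong)
  have idem: "\<rho> *v (\<rho> *v u) = \<rho> *v u" for u
    by (subst \<rho>) (simp add: orth)
  obtain w where w: "\<rho> *v w \<noteq> 0"
  proof -
    obtain r :: "'n \<Rightarrow> nat" where r: "bij_betw r UNIV {..<CARD('n)}"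
      using ex_bij_betw_finite_nat[of "UNIV :: 'n set"] by (auto simp: atLeast0LessThan)
    \<comment> \<open>The complement is not zero: the fewer than \<open>n\<close> orthogonality conditions are the rows of a square
      matrix with a zero row.\<close>
    define A :: "complex^'n^'n" where "A = (\<chi> i j. if r i < k then cnj (v (r i) $ j) else 0)"
    have ex: "\<exists>i. r i = l" if "l \<le> k" for l
    proof -
      have "l \<in> range r" using bij_betw_imp_surj_on[OF r] that Suc.prems by simp
      then show ?thesis by auto
    qed
    then obtain i where "r i = k" by blast
    then have "row i A = 0" by (simp add: row_def A_def vec_eq_iff)
    then have "det A = 0" by (rule det_zero_row)
    then obtain u where u: "u \<noteq> 0" "A *v u = 0" by (rule kernel_vector_if_det_zero)
    have "cinner (v l) u = 0" if "l < k" for l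
    proof -
      obtain i where i: "r i = l" using ex[of l] \<open>l < k\<close> by auto
      have "(A *v u) $ i = 0" using u(2) by simp
      then show ?thesis using i that by (simp add: A_def matrix_vector_mult_def cinner_def)
    qed
    then have "\<rho> *v u = u" by (simp add: \<rho>)
    with u(1) that show ?thesis by metis
  qed
  obtain u c where u: "u \<noteq> 0" "\<rho> *v u = u" "\<rho> *v (X *v u) = c *s u"
    using compression_has_eigenvector[OF idem w] by blast
  define e where "e = of_real (inverse (norm u)) *s u"
  define v' where "v' = v(k := e)"
  have e1: "cinner e e = 1"
  proof -
    have "cinner e e = of_real (inverse (norm u)) * (of_real (inverse (norm u)) * of_real ((norm u)\<^sup>2))"
      by (simp add: e_def cinner_scale cinner_scale_left) (simp add: cinner_self)
    then show ?thesis using u(1) by (simp add: power2_eq_square field_simps)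
  qed
  have e2: "cinner (v l) e = 0" if "l < k" for l
    using orth[OF that, of u] by (simp add: e_def cinner_scale u(2))
  have e3: "cinner e (v l) = 0" if "l < k" for l
    using e2[OF that] by (subst cinner_commute) simp
  have Xe: "X *v e = c *s e + (\<Sum>l<k. cinner (v l) (X *v e) *s v l)"
  proof -
    have "\<rho> *v (X *v e) = c *s e"
      by (simp add: e_def u(3) vector_scalar_commute mult.commute)
    then show ?thesis by (simp add: \<rho> algebra_simps)
  qed
  show ?case
  proof (intro exI[of _ v'] conjI allI impI)
    fix i j assume "i < Suc k" "j < Suc k"
    then show "cinner (v' i) (v' j) = of_bool (i = j)"
      by (auto simp: v'_def less_Suc_eq on e1 e2 e3)
  next
    fix j assume j: "j < Suc k"
    show "\<exists>d. X *v v' j = (\<Sum>i\<le>j. d i *s v' i)"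
    proof (cases "j = k")
      case True
      have "X *v v' j = (\<Sum>i\<le>j. (if i = k then c else cinner (v i) (X *v e)) *s v' i)"
        by (simp add: True v'_def lessThan_Suc_atMost[symmetric], subst add.commute, rule Xe)
      then show ?thesis
        by (rule exI[where x = "\<lambda>i. if i = k then c else cinner (v i) (X *v e)"])
    next
      case False
      with j flag[of j] obtain d where d: "X *v v j = (\<Sum>i\<le>j. d i *s v i)" by auto
      have "X *v v' j = (\<Sum>i\<le>j. d i *s v' i)"
        using d False j by (simp add: v'_def)
      then show ?thesis by (rule exI[where x = d])
    qed
  qed
qed simp

definition diag_mat :: "('n \<Rightarrow> 'a::zero) \<Rightarrow> 'a^'n^'n" where
  "diag_mat d = (\<chi> i j. if i = j then d i else 0)"

lemma diag_mat_nth [simp]: "diag_mat d $ i $ j = (if i = j then d i else 0)"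
  by (simp add: diag_mat_def)

lemma diag_mat_mult: "diag_mat d ** diag_mat e = (diag_mat (\<lambda>i. d i * e i) :: 'a::semiring_1^'n^'n)"
  by (simp add: vec_eq_iff matrix_matrix_mult_def if_distrib[where f = "\<lambda>c. c * _"] cong: if_cong)

lemma diag_mat_one: "diag_mat (\<lambda>_. 1) = mat 1"
  by (simp add: vec_eq_iff mat_def)

lemma adjoint_matrix_nth [simp]: "adjoint_matrix X $ i $ j = cnj (X $ j $ i)"
  by (simp add: adjoint_matrix_def transpose_def)

lemma adjoint_matrix_mult: "adjoint_matrix (A ** B) = adjoint_matrix B ** adjoint_matrix A"
  by (simp add: vec_eq_iff matrix_matrix_mult_def mult.commute)

lemma adjoint_matrix_adjoint_matrix [simp]: "adjoint_matrix (adjoint_matrix A) = A"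
  by (simp add: vec_eq_iff)

lemma adjoint_matrix_mat_1 [simp]: "adjoint_matrix (mat 1) = mat 1"
  by (simp add: vec_eq_iff mat_def)

lemma adjoint_diag_mat: "adjoint_matrix (diag_mat d) = diag_mat (\<lambda>i. cnj (d i))"
  by (simp add: vec_eq_iff)

lemma continuous_on_adjoint_matrix [continuous_intros]:
  "continuous_on T f \<Longrightarrow> continuous_on T (\<lambda>x. adjoint_matrix (f x))"
  unfolding adjoint_matrix_def map_matrix_def transpose_def by (simp, intro continuous_intros)

lemma unitary_matrixI: "adjoint_matrix V ** V = mat 1 \<Longrightarrow> unitary_matrix V"
  by (simp add: unitary_matrix_def matrix_left_right_inverse)

lemma unitary_matrixD:
  assumes "unitary_matrix V"
  shows "adjoint_matrix V ** V = mat 1" "V ** adjoint_matrix V = mat 1"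
  using assms by (simp_all add: unitary_matrix_def)

lemma unitary_matrix_adjoint: "unitary_matrix V \<Longrightarrow> unitary_matrix (adjoint_matrix V)"
  by (simp add: unitary_matrix_def)

lemma cancel_mid:
  fixes A B C D :: "'a::semiring_1^'n^'n"
  assumes "B ** C = mat 1"
  shows "A ** B ** (C ** D) = A ** D" "A ** B ** C = A"
  using assms by (metis matrix_mul_assoc matrix_mul_rid)+

lemma unitary_matrix_mult:
  assumes "unitary_matrix V" "unitary_matrix W"
  shows "unitary_matrix (V ** W)"
  using unitary_matrixD[OF assms(1)] unitary_matrixD[OF assms(2)]
  by (intro unitary_matrixI)
    (simp add: adjoint_matrix_mult cancel_mid matrix_mul_assoc[of _ V W, symmetric])

lemma unitary_mat_1: "unitary_matrix (mat 1)"
  by (simp add: unitary_matrix_def)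

lemma unitary_diag_mat_iff: "unitary_matrix (diag_mat d) \<longleftrightarrow> (\<forall>i. cmod (d i) = 1)"
proof -
  have "cnj z * z = 1 \<longleftrightarrow> cmod z = 1" for z
    by (metis complex_norm_square mult.commute norm_ge_zero norm_one of_real_1 of_real_eq_iff
        of_real_power power_one real_sqrt_abs2 real_sqrt_eq_iff abs_of_nonneg power2_eq_square)
  then show ?thesis
    by (auto simp: unitary_matrix_def adjoint_diag_mat diag_mat_mult diag_mat_one[symmetric] vec_eq_iff
        mult.commute)
qed

text \<open>
  The columns of \<open>V\<close> are an orthonormal basis adapted to a full invariant flag of \<open>X\<close>.
\<close>

theorem schur_triangularization:
  fixes X :: "complex^'n^'n"
  obtains V T and r :: "'n \<Rightarrow> nat"
    where "unitary_matrix V" "inj r" "\<And>i j. r j < r i \<Longrightarrow> T $ i $ j = 0"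
      "X = V ** T ** adjoint_matrix V"
proof -
  obtain v :: "nat \<Rightarrow> complex^'n" where
      on: "\<And>i j. i < CARD('n) \<Longrightarrow> j < CARD('n) \<Longrightarrow> cinner (v i) (v j) = of_bool (i = j)"
      and flag: "\<And>j. j < CARD('n) \<Longrightarrow> \<exists>c. X *v v j = (\<Sum>i\<le>j. c i *s v i)"
    using orthonormal_flag[of "CARD('n)" X] by blast
  obtain r :: "'n \<Rightarrow> nat" where r: "bij_betw r UNIV {..<CARD('n)}"
    using ex_bij_betw_finite_nat[of "UNIV :: 'n set"] by (auto simp: atLeast0LessThan)
  then have inj: "inj r" and less: "r i < CARD('n)" for i
    by (auto simp: bij_betw_def)
  define V :: "complex^'n^'n" where "V = (\<chi> i j. v (r j) $ i)"
  define T where "T = adjoint_matrix V ** X ** V"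
  have entry: "(adjoint_matrix V ** Y) $ i $ j = cinner (v (r i)) (column j Y)" for Y :: "complex^'n^'n" and i j
    by (simp add: matrix_matrix_mult_def V_def cinner_def column_def)
  have colV: "column j V = v (r j)" for j
    by (simp add: column_def V_def vec_eq_iff)
  have colXV: "column j (X ** V) = X *v v (r j)" for j
    by (simp add: column_def V_def vec_eq_iff matrix_matrix_mult_def matrix_vector_mult_def)
  have V: "unitary_matrix V"
    by (rule unitary_matrixI)
      (simp add: vec_eq_iff entry colV on less mat_def inj_eq[OF inj])
  moreover have "T $ i $ j = 0" if "r j < r i" for i j
  proof -
    obtain c where c: "X *v v (r j) = (\<Sum>l\<le>r j. c l *s v l)" using flag[OF less] by blast
    have "T $ i $ j = cinner (v (r i)) (X *v v (r j))"
      unfolding T_def matrix_mul_assoc[symmetric] entry colXV ..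
    also have "\<dots> = (\<Sum>l\<le>r j. c l * cinner (v (r i)) (v l))"
      by (simp add: c cinner_sum cinner_scale)
    also have "\<dots> = 0"
      using that less[of i] less[of j] by (intro sum.neutral) (auto simp: on)
    finally show ?thesis .
  qed
  moreover have "X = V ** T ** adjoint_matrix V"
    using unitary_matrixD[OF V] by (simp add: T_def matrix_mul_assoc cancel_mid)
  ultimately show ?thesis using inj that by metis
qed

text \<open>
  Comparing the diagonals of \<open>T T*\<close> and \<open>T* T\<close> shows that the \<open>i\<close>-th row and the \<open>i\<close>-th column of \<open>T\<close>
  have the same norm. By induction on the rank, the column has only its diagonal entry, so the row
  has only this entry too.
\<close>

lemma triangular_normal_imp_diagonal:
  fixes T :: "complex^'n^'n" and r :: "'n \<Rightarrow> nat"
  assumes inj: "inj r" and tri: "\<And>i j. r j < r i \<Longrightarrow> T $ i $ j = 0" and "normal_matrix T"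
  shows "T = diag_mat (\<lambda>i. T $ i $ i)"
proof -
  have rows: "(\<Sum>j\<in>UNIV. (cmod (T $ i $ j))\<^sup>2) = (\<Sum>j\<in>UNIV. (cmod (T $ j $ i))\<^sup>2)" for i
  proof -
    have "(T ** adjoint_matrix T) $ i $ i = (adjoint_matrix T ** T) $ i $ i"
      using assms(3) by (simp add: normal_matrix_def)
    then have "complex_of_real (\<Sum>j\<in>UNIV. (cmod (T $ i $ j))\<^sup>2)
        = complex_of_real (\<Sum>j\<in>UNIV. (cmod (T $ j $ i))\<^sup>2)"
      by (simp add: matrix_matrix_mult_def complex_norm_square mult.commute del: of_real_power)
    then show ?thesis by (simp only: of_real_eq_iff)
  qed
  have "\<forall>j. j \<noteq> i \<longrightarrow> T $ i $ j = 0" for i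
  proof (induction "r i" arbitrary: i rule: less_induct)
    case less
    have col: "T $ j $ i = 0" if "j \<noteq> i" for j
      using that tri[of i j] less[of j] inj by (metis linorder_neqE_nat inj_eq)
    have split: "(\<Sum>j\<in>UNIV. f j) = f i + (\<Sum>j\<in>UNIV - {i}. f j)" for f :: "'n \<Rightarrow> real"
      by (simp add: sum.remove)
    have "(\<Sum>j\<in>UNIV - {i}. (cmod (T $ i $ j))\<^sup>2) = 0"
      using rows[of i] unfolding split by (simp add: col)
    then show ?case by (simp add: sum_nonneg_eq_0_iff)
  qed
  then show ?thesis by (simp add: vec_eq_iff)
qed

theorem normal_imp_unitarily_diagonalizable:
  fixes X :: "complex^'n^'n"
  assumes "normal_matrix X"
  obtains V d where "unitary_matrix V" "X = V ** diag_mat d ** adjoint_matrix V"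
proof -
  obtain V T and r :: "'n \<Rightarrow> nat" where V: "unitary_matrix V" and r: "inj r"
    and T: "\<And>i j. r j < r i \<Longrightarrow> T $ i $ j = 0" and X: "X = V ** T ** adjoint_matrix V"
    by (rule schur_triangularization) blast
  note VV = unitary_matrixD[OF V]
  have TX: "T = adjoint_matrix V ** X ** V"
    using VV by (simp add: X matrix_mul_assoc cancel_mid)
  have eq: "X ** adjoint_matrix X = adjoint_matrix X ** X"
    using assms by (simp add: normal_matrix_def)
  have "T ** adjoint_matrix T = adjoint_matrix V ** (X ** adjoint_matrix X) ** V"
    "adjoint_matrix T ** T = adjoint_matrix V ** (adjoint_matrix X ** X) ** V"
    unfolding TX using VV by (simp_all add: adjoint_matrix_mult matrix_mul_assoc cancel_mid)
  then have "normal_matrix T" by (simp add: normal_matrix_def eq)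
  then have "T = diag_mat (\<lambda>i. T $ i $ i)"
    using triangular_normal_imp_diagonal[OF r] T by blast
  with that V X show ?thesis by metis
qed

lemma unitary_imp_normal: "unitary_matrix V \<Longrightarrow> normal_matrix V"
  by (simp add: unitary_matrix_def normal_matrix_def)

lemma unitary_conj_diag_exp:
  assumes "unitary_matrix U"
  obtains V \<theta> where "unitary_matrix V" "U = V ** diag_mat (\<lambda>i. exp (\<i> * of_real (\<theta> i))) ** adjoint_matrix V"
proof -
  obtain V d where V: "unitary_matrix V" and U: "U = V ** diag_mat d ** adjoint_matrix V"
    using normal_imp_unitarily_diagonalizable[OF unitary_imp_normal[OF assms]] by blast
  have "diag_mat d = adjoint_matrix V ** (U ** V)"
    using unitary_matrixD[OF V] by (simp add: U matrix_mul_assoc cancel_mid)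
  then have "unitary_matrix (diag_mat d)"
    using V assms by (simp add: unitary_matrix_mult unitary_matrix_adjoint)
  then have "\<forall>i. \<exists>t. d i = exp (\<i> * of_real t)"
    by (metis unitary_diag_mat_iff cis_conv_exp cis_Arg complex_norm_eq_1_exp)
  then obtain \<theta> where "d = (\<lambda>i. exp (\<i> * of_real (\<theta> i)))" by metis
  with that V U show ?thesis by metis
qed

text \<open>
  Diagonalize \<open>U\<close> and multiply the arguments of its eigenvalues by \<open>t\<close>.
\<close>

lemma unitary_path_from_one:
  fixes U :: "complex^'n^'n"
  assumes "unitary_matrix U"
  obtains R :: "real \<Rightarrow> complex^'n^'n"
    where "continuous_on UNIV R" "\<And>t. unitary_matrix (R t)" "R 0 = mat 1" "R 1 = U"
proof -
  obtain V \<theta> where V: "unitary_matrix V"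
      and U: "U = V ** diag_mat (\<lambda>i. exp (\<i> * of_real (\<theta> i))) ** adjoint_matrix V"
    by (rule unitary_conj_diag_exp[OF assms])
  define R where "R t = V ** diag_mat (\<lambda>i. exp (\<i> * of_real (t * \<theta> i))) ** adjoint_matrix V" for t
  have "continuous_on UNIV (\<lambda>t. if i = j then exp (\<i> * of_real (t * \<theta> i)) else 0)" for i j
    by (cases "i = j") (simp_all, intro continuous_intros)
  then have "continuous_on UNIV R" unfolding R_def diag_mat_def by (intro continuous_intros)
  moreover have "unitary_matrix (R t)" for t
    unfolding R_def using V
    by (intro unitary_matrix_mult unitary_matrix_adjoint) (simp_all add: unitary_diag_mat_iff)
  moreover have "R 0 = mat 1" using unitary_matrixD[OF V] by (simp add: R_def diag_mat_one)
  ultimately show ?thesis using that U by (simp add: R_def)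
qed

section \<open>Eigenvalue multiplicities along paths\<close>

lemma prod_linear_powers_unique:
  fixes \<mu> :: "'n::finite \<Rightarrow> complex"
  assumes inj: "inj \<mu>"
    and eq: "(\<Prod>k\<in>UNIV. [:- \<mu> k, 1:] ^ d k) = (\<Prod>k\<in>UNIV. [:- \<mu> k, 1:] ^ d' k)"
  shows "d = d'"
proof
  fix k
  have "count (proots (\<Prod>l\<in>UNIV. [:- \<mu> l, 1:] ^ e l)) (\<mu> k) = e k" for e
    by (simp add: proots_prod proots_power count_sum inj_eq[OF inj] if_distrib[where f = "\<lambda>c. _ * c"]
        cong: if_cong)
  then show "d k = d' k" using eq by metis
qed

lemma charpoly_factors_over_spectrum_bound:
  fixes Y :: "complex^'m^'m" and \<mu> :: "'n::finite \<Rightarrow> complex"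
  assumes inj: "inj \<mu>" and sub: "spectrum Y \<subseteq> range \<mu>"
  obtains d where "charpoly Y = (\<Prod>k\<in>UNIV. [:- \<mu> k, 1:] ^ d k)"
proof -
  have p0: "charpoly Y \<noteq> 0" using lead_coeff_charpoly[of Y] by auto
  obtain A where A: "charpoly Y = (\<Prod>x\<in>#A. [:- x, 1:])"
    using alg_closed_imp_factorization[OF p0] by (auto simp: lead_coeff_charpoly)
  have "set_mset A \<subseteq> range \<mu>"
  proof
    fix x assume "x \<in># A"
    then have "poly (charpoly Y) x = 0" by (auto simp: A poly_prod_mset prod_mset_zero_iff)
    with sub show "x \<in> range \<mu>" by (auto simp: mem_spectrum_iff)
  qed
  then have "charpoly Y = (\<Prod>x\<in>range \<mu>. [:- x, 1:] ^ count A x)"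
    unfolding A image_prod_mset_multiplicity
    by (intro prod.mono_neutral_left) (auto simp: not_in_iff)
  also have "\<dots> = (\<Prod>k\<in>UNIV. [:- \<mu> k, 1:] ^ count A (\<mu> k))"
    using inj by (simp add: prod.reindex)
  finally show ?thesis by (rule that)
qed

lemma sum_multiplicities:
  fixes Y :: "complex^'m^'m" and \<mu> :: "'n::finite \<Rightarrow> complex"
  assumes "charpoly Y = (\<Prod>k\<in>UNIV. [:- \<mu> k, 1:] ^ d k)"
  shows "(\<Sum>k\<in>UNIV. d k) = CARD('m)"
  using degree_charpoly[of Y] unfolding assms
  by (subst (asm) degree_prod_sum_eq) (simp_all add: degree_power_eq)

lemma continuous_on_charpoly:
  fixes Y :: "real \<Rightarrow> complex^'m^'m"
  assumes "continuous_on T Y"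
  shows "continuous_on T (\<lambda>t. poly (charpoly (Y t)) x)"
  unfolding poly_charpoly by (intro continuous_intros assms)

text \<open>
  For every vector \<open>e\<close> of exponents, the set \<open>C e\<close> of parameters at which the factorization with these
  exponents holds is closed. These sets are disjoint, because the \<open>\<mu> t k\<close> are distinct, and finitely
  many of them cover the interval, because the exponents add up to \<open>m\<close>. As the interval is connected,
  it lies in a single one.
\<close>

lemma multiplicities_constant_along_path:
  fixes Y :: "real \<Rightarrow> complex^'m^'m" and \<mu> :: "real \<Rightarrow> 'n::finite \<Rightarrow> complex"
  assumes Y: "continuous_on {0..1} Y" and \<mu>: "\<And>k. continuous_on {0..1} (\<lambda>t. \<mu> t k)"
    and inj: "\<And>t. t \<in> {0..1} \<Longrightarrow> inj (\<mu> t)"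
    and sub: "\<And>t. t \<in> {0..1} \<Longrightarrow> spectrum (Y t) \<subseteq> range (\<mu> t)"
    and start: "charpoly (Y 0) = (\<Prod>k\<in>UNIV. [:- \<mu> 0 k, 1:] ^ d k)"
  shows "charpoly (Y 1) = (\<Prod>k\<in>UNIV. [:- \<mu> 1 k, 1:] ^ d k)"
proof -
  define C where "C e = {t \<in> {0..1}. charpoly (Y t) = (\<Prod>k\<in>UNIV. [:- \<mu> t k, 1:] ^ e k)}" for e
  have closed: "closed (C e)" for e
  proof -
    have "C e = (\<Inter>x. {t \<in> {0..1}. poly (charpoly (Y t)) x - (\<Prod>k\<in>UNIV. (x - \<mu> t k) ^ e k) = 0})"
      by (auto simp: C_def poly_eq_poly_eq_iff[symmetric] fun_eq_iff poly_prod)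
    also have "closed \<dots>"
      by (intro closed_INT ballI continuous_closed_preimage_constant continuous_intros \<mu>
          continuous_on_charpoly[OF Y] closed_atLeastAtMost)
    finally show ?thesis .
  qed
  define E where "E = {e :: 'n \<Rightarrow> nat. range e \<subseteq> {..CARD('m)}}"
  have E: "e \<in> E" if "t \<in> C e" for e t
  proof -
    have "e k \<le> CARD('m)" for k
      using sum_multiplicities[of "Y t" "\<mu> t" e] that member_le_sum[of k UNIV e] by (auto simp: C_def)
    then show ?thesis by (auto simp: E_def)
  qed
  have "finite (PiE (UNIV :: 'n set) (\<lambda>_. {..CARD('m)}))" by (intro finite_PiE) auto
  then have "finite E" unfolding E_def by (rule rev_finite_subset) (auto simp: PiE_def)
  then have closed_rest: "closed (\<Union>e\<in>E - {d}. C e)" using closed by (intro closed_UN) auto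
  have cover: "{0..1} \<subseteq> C d \<union> (\<Union>e\<in>E - {d}. C e)"
  proof
    fix t :: real assume t: "t \<in> {0..1}"
    obtain e where "charpoly (Y t) = (\<Prod>k\<in>UNIV. [:- \<mu> t k, 1:] ^ e k)"
      by (rule charpoly_factors_over_spectrum_bound[OF inj[OF t] sub[OF t]])
    with t have "t \<in> C e" by (simp add: C_def)
    then show "t \<in> C d \<union> (\<Union>e\<in>E - {d}. C e)" using E by blast
  qed
  have disj: "C d \<inter> (\<Union>e\<in>E - {d}. C e) \<inter> {0..1} = {}"
    using prod_linear_powers_unique[OF inj] by (auto simp: C_def)
  have "0 \<in> C d" using start by (simp add: C_def)
  then have "(\<Union>e\<in>E - {d}. C e) \<inter> {0..1} = {}"
    using connected_closedD[OF connected_Icc disj cover closed closed_rest] by auto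
  moreover have "1 \<in> C d \<union> (\<Union>e\<in>E - {d}. C e)" by (rule subsetD[OF cover]) simp
  ultimately have "1 \<in> C d" by auto
  then show ?thesis by (simp add: C_def)
qed

section \<open>Monodromy of the eigenvalues\<close>

lemma mat_comm:
  fixes A :: "'a::comm_semiring_1^'n^'n"
  shows "mat x ** A = A ** mat x"
  by (simp add: vec_eq_iff matrix_matrix_mult_def mat_def if_distrib[where f = "\<lambda>c. _ * c"]
      if_distrib[where f = "\<lambda>c. c * _"] mult.commute cong: if_cong)

lemma charpoly_similar_triangular:
  fixes P Q T :: "complex^'n^'n" and r :: "'n \<Rightarrow> nat"
  assumes PQ: "P ** Q = mat 1" and inj: "inj r" and tri: "\<And>i j. r j < r i \<Longrightarrow> T $ i $ j = 0"
  shows "charpoly (P ** T ** Q) = (\<Prod>k\<in>UNIV. [:- (T $ k $ k), 1:])"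
proof -
  have "poly (charpoly (P ** T ** Q)) x = (\<Prod>k\<in>UNIV. x - T $ k $ k)" for x
  proof -
    have diff: "A ** (B - C) = A ** B - A ** C" "(B - C) ** A = B ** A - C ** A" for A B C :: "complex^'n^'n"
      by (simp_all add: vec_eq_iff matrix_matrix_mult_def algebra_simps sum_subtractf)
    have "P ** mat x ** Q = mat x ** (P ** Q)"
      by (simp only: mat_comm[of x P, symmetric] matrix_mul_assoc)
    then have "mat x - P ** T ** Q = P ** (mat x - T) ** Q"
      by (simp add: diff PQ)
    then have "det (mat x - P ** T ** Q) = det (mat x - T) * det (P ** Q)"
      by (simp add: det_mul)
    also have "\<dots> = (\<Prod>k\<in>UNIV. (mat x - T) $ k $ k)"
    proof (subst det_triangular[OF inj])
      show "(mat x - T) $ i $ j = 0" if "r j < r i" for i j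
        using that tri[OF that] by (auto simp: mat_def)
    qed (simp add: PQ)
    finally show ?thesis by (simp add: poly_charpoly mat_def)
  qed
  then show ?thesis by (simp add: poly_eq_poly_eq_iff[symmetric] fun_eq_iff poly_prod)
qed

lemma spectrum_similar_triangular:
  fixes P Q T :: "complex^'n^'n" and r :: "'n \<Rightarrow> nat"
  assumes "P ** Q = mat 1" and "inj r" and "\<And>i j. r j < r i \<Longrightarrow> T $ i $ j = 0"
  shows "spectrum (P ** T ** Q) = range (\<lambda>k. T $ k $ k)"
proof -
  have "charpoly (P ** T ** Q) = (\<Prod>k\<in>UNIV. [:- (T $ k $ k), 1:])"
    using assms by (rule charpoly_similar_triangular)
  then show ?thesis by (auto simp: mem_spectrum_iff poly_prod)
qed

lemma charpoly_similar_diag: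
  fixes P Q :: "complex^'n^'n"
  assumes "P ** Q = mat 1"
  shows "charpoly (P ** diag_mat \<mu> ** Q) = (\<Prod>k\<in>UNIV. [:- \<mu> k, 1:])"
    and "spectrum (P ** diag_mat \<mu> ** Q) = range \<mu>"
proof -
  obtain r :: "'n \<Rightarrow> nat" where r: "inj r" by (rule ex_inj_nat)
  have tri: "\<And>i j. r j < r i \<Longrightarrow> diag_mat \<mu> $ i $ j = 0" by auto
  show "charpoly (P ** diag_mat \<mu> ** Q) = (\<Prod>k\<in>UNIV. [:- \<mu> k, 1:])"
    using charpoly_similar_triangular[OF assms r tri] by simp
  show "spectrum (P ** diag_mat \<mu> ** Q) = range \<mu>"
    using spectrum_similar_triangular[OF assms r tri] by simp
qed

lemma continuous_on_diag_mat:
  fixes \<mu> :: "'a::topological_space \<Rightarrow> 'n::finite \<Rightarrow> complex"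
  assumes "\<And>k. continuous_on T (\<lambda>t. \<mu> t k)"
  shows "continuous_on T (\<lambda>t. diag_mat (\<mu> t))"
proof -
  have "continuous_on T (\<lambda>t. if i = j then \<mu> t i else 0)" for i j
    using assms by (cases "i = j") simp_all
  then show ?thesis unfolding diag_mat_def by (intro continuous_intros)
qed

text \<open>
  The hypothesis \<open>loop\<close> says that the path of eigenvalues leads from the permuted tuple back to the
  original one. It is preceded by a path of conjugations, on which the eigenvalues do not move, from
  the diagonal matrix of \<open>\<mu> 1\<close> to that of \<open>\<mu> 1 \<circ> \<sigma>\<close>. Along the first path the exponents stay
  with the numbers \<open>\<mu> 1 k\<close>, along the second with the indices \<open>k\<close>.
\<close>

lemma multiplicities_invariant_under_monodromy:
  fixes \<phi> :: "complex^'n^'n \<Rightarrow> complex^'m^'m" and \<mu> :: "real \<Rightarrow> 'n \<Rightarrow> complex"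
  assumes \<phi>: "continuous_on S \<phi>" "spectrum_shrinking_on S \<phi>"
    and PQ: "P ** Q = mat 1"
    and \<sigma>: "bij \<sigma>" and loop: "\<mu> 0 = \<mu> 1 \<circ> \<sigma>"
    and \<mu>: "\<And>k. continuous_on {0..1} (\<lambda>t. \<mu> t k)" "\<And>t. t \<in> {0..1} \<Longrightarrow> inj (\<mu> t)"
    and S\<mu>: "\<And>t. t \<in> {0..1} \<Longrightarrow> P ** diag_mat (\<mu> t) ** Q \<in> S"
    and SR: "\<And>R. unitary_matrix R \<Longrightarrow> P ** (R ** diag_mat (\<mu> 1) ** adjoint_matrix R) ** Q \<in> S"
    and d: "charpoly (\<phi> (P ** diag_mat (\<mu> 1) ** Q)) = (\<Prod>k\<in>UNIV. [:- \<mu> 1 k, 1:] ^ d k)"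
  shows "d \<circ> \<sigma> = d"
proof -
  define U :: "complex^'n^'n" where "U = (\<chi> i j. if j = \<sigma> i then 1 else 0)"
  have inj\<sigma>: "\<sigma> i = \<sigma> j \<longleftrightarrow> i = j" for i j using \<sigma> by (auto simp: bij_def inj_eq)
  have conjU: "U ** diag_mat \<nu> ** adjoint_matrix U = diag_mat (\<nu> \<circ> \<sigma>)" for \<nu>
  proof -
    have UD: "(U ** diag_mat \<nu>) $ i $ j = (if j = \<sigma> i then \<nu> j else 0)" for i j
      by (simp add: matrix_matrix_mult_def U_def if_distrib[where f = "\<lambda>c. _ * c"] cong: if_cong)
    have "(U ** diag_mat \<nu> ** adjoint_matrix U) $ i $ k = \<nu> (\<sigma> i) * cnj (U $ k $ \<sigma> i)" for i k
      unfolding matrix_matrix_mult_def[of "U ** diag_mat \<nu>"]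
      by (simp add: UD if_distrib[where f = "\<lambda>c. c * _"] cong: if_cong)
    then show ?thesis by (simp add: vec_eq_iff U_def inj\<sigma>)
  qed
  have "U ** adjoint_matrix U = mat 1"
    using conjU[of "\<lambda>_. 1"] by (simp add: diag_mat_one comp_def)
  then have "unitary_matrix U" by (simp add: unitary_matrix_def matrix_left_right_inverse)
  then obtain R :: "real \<Rightarrow> complex^'n^'n"
    where R: "continuous_on UNIV R" "\<And>t. unitary_matrix (R t)" "R 0 = mat 1" "R 1 = U"
    by (rule unitary_path_from_one) blast
  have inj1: "inj (\<mu> 1)" using \<mu>(2) by simp
  define X where "X t = P ** (R t ** diag_mat (\<mu> 1) ** adjoint_matrix (R t)) ** Q" for t
  have X_S: "X t \<in> S" for t unfolding X_def by (rule SR[OF R(2)])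
  have contR: "continuous_on {0..1} R" using R(1) continuous_on_subset by blast
  have contX: "continuous_on {0..1} X" unfolding X_def by (intro continuous_intros contR)
  have specX: "spectrum (X t) = range (\<mu> 1)" for t
  proof -
    have "(P ** R t) ** (adjoint_matrix (R t) ** Q) = mat 1"
      using unitary_matrixD(2)[OF R(2)] PQ by (simp add: cancel_mid)
    from charpoly_similar_diag(2)[OF this, of "\<mu> 1"] show ?thesis
      by (simp add: X_def matrix_mul_assoc)
  qed
  have X0: "X 0 = P ** diag_mat (\<mu> 1) ** Q" by (simp add: X_def R(3))
  have X1: "X 1 = P ** diag_mat (\<mu> 0) ** Q" by (simp add: X_def R(4) conjU loop)
  have "charpoly (\<phi> (X 1)) = (\<Prod>k\<in>UNIV. [:- \<mu> 1 k, 1:] ^ d k)"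
  proof (rule multiplicities_constant_along_path[where \<mu> = "\<lambda>_. \<mu> 1" and Y = "\<lambda>t. \<phi> (X t)"])
    show "continuous_on {0..1} (\<lambda>t. \<phi> (X t))"
      using X_S by (intro continuous_on_compose2[OF \<phi>(1) contX]) auto
    show "spectrum (\<phi> (X t)) \<subseteq> range (\<mu> 1)" for t
      using \<phi>(2) X_S[of t] specX[of t] by (auto simp: spectrum_shrinking_on_def)
  qed (use inj1 d X0 in simp_all)
  also have "\<dots> = (\<Prod>k\<in>UNIV. [:- \<mu> 1 (\<sigma> k), 1:] ^ d (\<sigma> k))"
    by (rule prod.reindex_bij_betw[OF \<sigma>, symmetric])
  finally have start: "charpoly (\<phi> (P ** diag_mat (\<mu> 0) ** Q)) = (\<Prod>k\<in>UNIV. [:- \<mu> 0 k, 1:] ^ (d \<circ> \<sigma>) k)"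
    by (simp add: X1 loop)
  have "charpoly (\<phi> (P ** diag_mat (\<mu> 1) ** Q)) = (\<Prod>k\<in>UNIV. [:- \<mu> 1 k, 1:] ^ (d \<circ> \<sigma>) k)"
  proof (rule multiplicities_constant_along_path[where \<mu> = \<mu> and Y = "\<lambda>t. \<phi> (P ** diag_mat (\<mu> t) ** Q)"])
    have "continuous_on {0..1} (\<lambda>t. P ** diag_mat (\<mu> t) ** Q)"
      by (intro continuous_intros continuous_on_diag_mat \<mu>(1))
    then show "continuous_on {0..1} (\<lambda>t. \<phi> (P ** diag_mat (\<mu> t) ** Q))"
      using S\<mu> by (intro continuous_on_compose2[OF \<phi>(1)]) auto
    show "spectrum (\<phi> (P ** diag_mat (\<mu> t) ** Q)) \<subseteq> range (\<mu> t)" if "t \<in> {0..1}" for t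
      using \<phi>(2) S\<mu>[OF that] charpoly_similar_diag(2)[OF PQ, of "\<mu> t"]
      by (auto simp: spectrum_shrinking_on_def)
  qed (use \<mu> start in simp_all)
  from trans[OF this[symmetric] d] show ?thesis by (rule prod_linear_powers_unique[OF inj1])
qed

text \<open>
  Divisibility is part of this relation because both are consequences of the equality of the exponents.
\<close>

definition charpoly_power :: "complex^'n^'n \<Rightarrow> complex^'m^'m \<Rightarrow> bool" where
  "charpoly_power X Y \<longleftrightarrow> CARD('n) dvd CARD('m) \<and> charpoly Y = charpoly X ^ (CARD('m) div CARD('n))"

lemma charpoly_powerI:
  fixes X :: "complex^'n^'n" and Y :: "complex^'m^'m" and \<mu> :: "'n \<Rightarrow> complex"
  assumes X: "charpoly X = (\<Prod>k\<in>UNIV. [:- \<mu> k, 1:])"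
    and Y: "charpoly Y = (\<Prod>k\<in>UNIV. [:- \<mu> k, 1:] ^ d k)"
    and d: "\<And>i j. d i = d j"
  shows "charpoly_power X Y"
proof -
  obtain e where e: "d = (\<lambda>_. e)" using d by (metis (full_types))
  have "CARD('n) * e = CARD('m)" using sum_multiplicities[OF Y] by (simp add: e)
  moreover from this have "e = CARD('m) div CARD('n)"
    by (metis nonzero_mult_div_cancel_left zero_less_card_finite less_not_refl)
  moreover have "charpoly Y = charpoly X ^ e" by (simp add: X Y e prod_power_distrib)
  ultimately show ?thesis unfolding charpoly_power_def by (metis dvd_triv_left)
qed

text \<open>
  The divisibility comes from any one good parameter, the identity of polynomials from continuity of
  both sides at every argument.
\<close>

lemma charpoly_power_limit:
  fixes X :: "real \<Rightarrow> complex^'n^'n" and \<phi> :: "complex^'n^'n \<Rightarrow> complex^'m^'m"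
  assumes \<phi>: "continuous_on S \<phi>" and X: "continuous_on {0..1} X" and XS: "\<And>t. t \<in> {0..1} \<Longrightarrow> X t \<in> S"
    and B: "countable B" and pw: "\<And>t. t \<in> {0<..<1} - B \<Longrightarrow> charpoly_power (X t) (\<phi> (X t))"
  shows "charpoly_power (X 0) (\<phi> (X 0))"
proof -
  let ?e = "CARD('m) div CARD('n)"
  have "uncountable ({0<..<1::real} - B)"
    using B by (simp add: uncountable_minus_countable uncountable_open_interval)
  then have "{0<..<1} - B \<noteq> {}" by (metis countable_empty)
  then obtain t where "t \<in> {0<..<1} - B" by blast
  with pw have "CARD('n) dvd CARD('m)" unfolding charpoly_power_def by blast
  moreover have "poly (charpoly (\<phi> (X 0))) x = poly (charpoly (X 0)) x ^ ?e" for x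
  proof (rule eq_at_0_if_eq_off_countable[OF _ _ B])
    have "continuous_on {0..1} (\<lambda>t. \<phi> (X t))"
      using XS by (intro continuous_on_compose2[OF \<phi> X]) auto
    then show "continuous_on {0..1} (\<lambda>t. poly (charpoly (\<phi> (X t))) x)"
      by (rule continuous_on_charpoly)
    show "continuous_on {0..1} (\<lambda>t. poly (charpoly (X t)) x ^ ?e)"
      by (intro continuous_intros continuous_on_charpoly X)
    show "poly (charpoly (\<phi> (X t))) x = poly (charpoly (X t)) x ^ ?e" if "t \<in> {0<..<1} - B" for t
      using pw[OF that] by (simp add: charpoly_power_def)
  qed
  ultimately show ?thesis
    by (simp add: charpoly_power_def poly_eq_poly_eq_iff[symmetric] fun_eq_iff)
qed

section \<open>Matrices parametrized by the logarithms of their eigenvalues\<close>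

text \<open>
  The solutions are the points at which a nonconstant affine function meets the period lattice of
  \<open>exp\<close>; a constant function has none, as its value is not a period.
\<close>

lemma countable_exp_coincidences:
  fixes \<alpha> \<beta> :: complex
  assumes "exp \<alpha> \<noteq> 1 \<or> \<beta> \<noteq> 0"
  shows "countable {z. exp (\<alpha> + z * \<beta>) = 1}"
proof -
  have "{z. exp (\<alpha> + z * \<beta>) = 1} \<subseteq> range (\<lambda>n::int. (of_int (2 * n) * pi * \<i> - \<alpha>) / \<beta>)"
  proof
    fix z assume "z \<in> {z. exp (\<alpha> + z * \<beta>) = 1}"
    then have z: "exp (\<alpha> + z * \<beta>) = exp 0" by simp
    then obtain n :: int where "\<alpha> + z * \<beta> = of_int (2 * n) * pi * \<i>"
      unfolding exp_eq by auto
    moreover have "\<beta> \<noteq> 0" using z assms by auto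
    ultimately have "z = (of_int (2 * n) * pi * \<i> - \<alpha>) / \<beta>"
      by (simp add: field_simps)
    then show "z \<in> range (\<lambda>n::int. (of_int (2 * n) * pi * \<i> - \<alpha>) / \<beta>)" by blast
  qed
  then show ?thesis by (rule countable_subset) simp
qed

lemma countable_noninjective_parameters:
  fixes a c :: "'n::finite \<Rightarrow> complex"
  assumes "\<And>k l. k \<noteq> l \<Longrightarrow> exp (a k) \<noteq> exp (a l) \<or> c k \<noteq> c l"
  shows "countable {z. \<not> inj (\<lambda>k. exp (a k + z * c k))}"
proof -
  have "{z. \<not> inj (\<lambda>k. exp (a k + z * c k))}
      \<subseteq> (\<Union>k. \<Union>l\<in>- {k}. {z. exp ((a k - a l) + z * (c k - c l)) = 1})"
  proof
    fix z assume "z \<in> {z. \<not> inj (\<lambda>k. exp (a k + z * c k))}"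
    then obtain k l where kl: "k \<noteq> l" "exp (a k + z * c k) = exp (a l + z * c l)"
      by (auto simp: inj_def)
    then have "exp ((a k + z * c k) - (a l + z * c l)) = 1" by (simp add: exp_diff)
    then have "exp ((a k - a l) + z * (c k - c l)) = 1" by (simp add: algebra_simps)
    with kl(1) show "z \<in> (\<Union>k. \<Union>l\<in>- {k}. {z. exp ((a k - a l) + z * (c k - c l)) = 1})"
      by (intro UN_I[of k] UN_I[of l]) simp_all
  qed
  moreover have "countable {z. exp ((a k - a l) + z * (c k - c l)) = 1}" if "k \<noteq> l" for k l
    using assms[OF that] by (intro countable_exp_coincidences) (simp add: exp_diff)
  then have "countable (\<Union>k. \<Union>l\<in>- {k}. {z. exp ((a k - a l) + z * (c k - c l)) = 1})"
    by (intro countable_UN) (auto intro: countable_finite)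
  ultimately show ?thesis by (rule countable_subset)
qed

text \<open>
  Directions for separating eigenvalues: the zero sum keeps the determinant fixed.
\<close>

lemma ex_injective_sum_zero:
  obtains c :: "'n::finite \<Rightarrow> real" where "inj c" "sum c UNIV = 0"
proof -
  obtain r :: "'n \<Rightarrow> nat" where r: "inj r" by (rule ex_inj_nat)
  define c where "c k = real (r k) - (\<Sum>l\<in>UNIV. real (r l)) / real CARD('n)" for k
  have "inj c" using r by (auto simp: inj_def c_def)
  moreover have "sum c UNIV = 0" by (simp add: c_def sum_subtractf)
  ultimately show ?thesis by (rule that)
qed

text \<open>
  The hypothesis on \<open>S\<close> lists all matrices that the argument visits: the diagonal part may be
  conjugated by unitary matrices, its logarithms may move as long as their sum does not, and the
  strictly triangular part \<open>N\<close> may shrink. With \<open>N = 0\<close> it is meant for spaces of diagonalizable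
  matrices, where a triangular part would leave the space.
\<close>

lemma charpoly_power_distinct_exponentials:
  fixes \<phi> :: "complex^'n^'n \<Rightarrow> complex^'m^'m" and a :: "'n \<Rightarrow> complex" and r :: "'n \<Rightarrow> nat"
  assumes \<phi>: "continuous_on S \<phi>" "spectrum_shrinking_on S \<phi>"
    and PQ: "P ** Q = mat 1" and r: "inj r" and N: "\<And>i j. \<not> r i < r j \<Longrightarrow> N $ i $ j = 0"
    and S: "\<And>R s b. unitary_matrix R \<Longrightarrow> s \<in> {0..1} \<Longrightarrow> sum b UNIV = sum a UNIV \<Longrightarrow>
        P ** (R ** (diag_mat (\<lambda>k. exp (b k)) + s *\<^sub>R N) ** adjoint_matrix R) ** Q \<in> S"
    and inj: "inj (\<lambda>k. exp (a k))"
  defines "X \<equiv> P ** (diag_mat (\<lambda>k. exp (a k)) + N) ** Q"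
  shows "charpoly_power X (\<phi> X)"
proof -
  have S1: "P ** (diag_mat (\<lambda>k. exp (b k)) + s *\<^sub>R N) ** Q \<in> S"
    if "s \<in> {0..1}" "sum b UNIV = sum a UNIV" for s b
    using S[OF unitary_mat_1 that] by simp
  have S0: "P ** diag_mat (\<lambda>k. exp (b k)) ** Q \<in> S" if "sum b UNIV = sum a UNIV" for b
    using S1[of 0 b] that by simp
  have "spectrum (\<phi> (P ** diag_mat (\<lambda>k. exp (a k)) ** Q)) \<subseteq> range (\<lambda>k. exp (a k))"
    using \<phi>(2) S0[OF refl] charpoly_similar_diag(2)[OF PQ] unfolding spectrum_shrinking_on_def by blast
  then obtain d where d: "charpoly (\<phi> (P ** diag_mat (\<lambda>k. exp (a k)) ** Q))
      = (\<Prod>k\<in>UNIV. [:- exp (a k), 1:] ^ d k)"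
    by (rule charpoly_factors_over_spectrum_bound[OF inj])
  have d_eq: "d i = d j" for i j
  proof -
    define \<sigma> where "\<sigma> = Transposition.transpose i j"
    have \<sigma>: "bij \<sigma>" by (simp add: \<sigma>_def)
    \<comment> \<open>The exponents of \<open>i\<close> and \<open>j\<close> are compared by the loop that exchanges these two eigenvalues: the
      logarithms move from \<open>a \<circ> \<sigma>\<close>, at \<open>g 0 = 1\<close>, to \<open>a\<close>, at \<open>g 1 = 0\<close>.\<close>
    define c where "c k = a (\<sigma> k) - a k" for k
    define B where "B = {z. \<not> inj (\<lambda>k. exp (a k + z * c k))}"
    have "countable B" unfolding B_def
      using inj by (intro countable_noninjective_parameters) (auto simp: inj_def)
    then have "path_connected (- B)" by (intro path_connected_complement_countable) simp_all
    moreover have "0 \<in> - B" using inj by (simp add: B_def)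
    moreover have "1 \<in> - B"
      using inj_compose[OF inj bij_is_inj[OF \<sigma>]] by (simp add: B_def c_def comp_def)
    ultimately obtain g where g: "path g" "path_image g \<subseteq> - B" "pathstart g = 1" "pathfinish g = 0"
      unfolding path_connected_def by blast
    have "(\<Sum>k\<in>UNIV. a (\<sigma> k)) = sum a UNIV" by (rule sum.reindex_bij_betw[OF \<sigma>])
    then have sum_c: "sum c UNIV = 0" by (simp add: c_def sum_subtractf)
    have "d \<circ> \<sigma> = d"
    proof (rule multiplicities_invariant_under_monodromy[OF \<phi> PQ \<sigma>,
          where \<mu> = "\<lambda>t k. exp (a k + g t * c k)"])
      show "(\<lambda>k. exp (a k + g 0 * c k)) = (\<lambda>k. exp (a k + g 1 * c k)) \<circ> \<sigma>"
        using g(3,4) by (simp add: pathstart_def pathfinish_def c_def fun_eq_iff)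
      show "continuous_on {0..1} (\<lambda>t. exp (a k + g t * c k))" for k
        using g(1) unfolding path_def by (intro continuous_intros)
      show "inj (\<lambda>k. exp (a k + g t * c k))" if "t \<in> {0..1}" for t
      proof -
        have "g t \<in> - B" using g(2) that unfolding path_image_def by blast
        then show ?thesis by (simp add: B_def)
      qed
      show "P ** diag_mat (\<lambda>k. exp (a k + g t * c k)) ** Q \<in> S" for t
        by (rule S0) (simp add: sum.distrib sum_distrib_left[symmetric] sum_c)
      show "P ** (R ** diag_mat (\<lambda>k. exp (a k + g 1 * c k)) ** adjoint_matrix R) ** Q \<in> S"
        if "unitary_matrix R" for R
        using S[OF that, of 0 a] g(4) by (simp add: pathfinish_def)
      show "charpoly (\<phi> (P ** diag_mat (\<lambda>k. exp (a k + g 1 * c k)) ** Q))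
          = (\<Prod>k\<in>UNIV. [:- exp (a k + g 1 * c k), 1:] ^ d k)"
        using d g(4) by (simp add: pathfinish_def)
    qed
    then have "d (\<sigma> i) = d i" by (metis comp_apply)
    then show ?thesis by (simp add: \<sigma>_def)
  qed
  have tri: "(diag_mat (\<lambda>k. exp (a k)) + s *\<^sub>R N) $ i $ j = 0" if "r j < r i" for i j s
    using that N[of i j] by auto
  have diag: "(diag_mat (\<lambda>k. exp (a k)) + s *\<^sub>R N) $ k $ k = exp (a k)" for k s
    using N[of k k] by simp
  \<comment> \<open>Along the path that scales \<open>N\<close> from \<open>0\<close> to \<open>1\<close> the eigenvalues are constant.\<close>
  have "charpoly (\<phi> (P ** (diag_mat (\<lambda>k. exp (a k)) + 1 *\<^sub>R N) ** Q)) = (\<Prod>k\<in>UNIV. [:- exp (a k), 1:] ^ d k)"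
  proof (rule multiplicities_constant_along_path[where \<mu> = "\<lambda>_ k. exp (a k)"
        and Y = "\<lambda>s. \<phi> (P ** (diag_mat (\<lambda>k. exp (a k)) + s *\<^sub>R N) ** Q)"])
    have "continuous_on {0..1} (\<lambda>s. P ** (diag_mat (\<lambda>k. exp (a k)) + s *\<^sub>R N) ** Q)"
      by (intro continuous_intros)
    then show "continuous_on {0..1} (\<lambda>s. \<phi> (P ** (diag_mat (\<lambda>k. exp (a k)) + s *\<^sub>R N) ** Q))"
      using S1 by (intro continuous_on_compose2[OF \<phi>(1)]) auto
    show "spectrum (\<phi> (P ** (diag_mat (\<lambda>k. exp (a k)) + s *\<^sub>R N) ** Q)) \<subseteq> range (\<lambda>k. exp (a k))"
      if "s \<in> {0..1}" for s
      using \<phi>(2) S1[OF that refl] spectrum_similar_triangular[OF PQ r tri, of s]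
      unfolding spectrum_shrinking_on_def diag by blast
  qed (use inj d in simp_all)
  then have Y: "charpoly (\<phi> X) = (\<Prod>k\<in>UNIV. [:- exp (a k), 1:] ^ d k)" by (simp add: X_def)
  have "charpoly (P ** (diag_mat (\<lambda>k. exp (a k)) + 1 *\<^sub>R N) ** Q) = (\<Prod>k\<in>UNIV. [:- exp (a k), 1:])"
    using charpoly_similar_triangular[OF PQ r tri, of 1] unfolding diag .
  then have "charpoly X = (\<Prod>k\<in>UNIV. [:- exp (a k), 1:])" by (simp add: X_def)
  then show ?thesis using Y d_eq by (rule charpoly_powerI)
qed

lemma countable_noninjective_imaginary_times:
  fixes a :: "'n::finite \<Rightarrow> complex" and c :: "'n \<Rightarrow> real"
  assumes "inj c"
  shows "countable {t::real. \<not> inj (\<lambda>k. exp (a k + \<i> * of_real (t * c k)))}"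
proof -
  have "countable (Re ` {z. \<not> inj (\<lambda>k. exp (a k + z * (\<i> * of_real (c k))))})"
    using assms by (intro countable_image countable_noninjective_parameters) (auto simp: inj_eq)
  moreover have "{t::real. \<not> inj (\<lambda>k. exp (a k + \<i> * of_real (t * c k)))}
      \<subseteq> Re ` {z. \<not> inj (\<lambda>k. exp (a k + z * (\<i> * of_real (c k))))}"
    by (auto intro!: image_eqI[where x = "of_real _"] simp: mult.left_commute)
  ultimately show ?thesis by (rule countable_subset[rotated])
qed

text \<open>
  Coinciding eigenvalues are separated by the perturbation \<open>a k + \<i> t (c k)\<close> of the logarithms.
\<close>

theorem charpoly_power_exponentials:
  fixes \<phi> :: "complex^'n^'n \<Rightarrow> complex^'m^'m" and a :: "'n \<Rightarrow> complex" and r :: "'n \<Rightarrow> nat"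
  assumes \<phi>: "continuous_on S \<phi>" "spectrum_shrinking_on S \<phi>"
    and PQ: "P ** Q = mat 1" and r: "inj r" and N: "\<And>i j. \<not> r i < r j \<Longrightarrow> N $ i $ j = 0"
    and S: "\<And>R s b. unitary_matrix R \<Longrightarrow> s \<in> {0..1} \<Longrightarrow> sum b UNIV = sum a UNIV \<Longrightarrow>
        P ** (R ** (diag_mat (\<lambda>k. exp (b k)) + s *\<^sub>R N) ** adjoint_matrix R) ** Q \<in> S"
  defines "X \<equiv> P ** (diag_mat (\<lambda>k. exp (a k)) + N) ** Q"
  shows "charpoly_power X (\<phi> X)"
proof -
  obtain c :: "'n \<Rightarrow> real" where c: "inj c" "sum c UNIV = 0" by (rule ex_injective_sum_zero)
  define b where "b t k = a k + \<i> * of_real (t * c k)" for t k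
  have sum_b: "sum (b t) UNIV = sum a UNIV" for t
  proof -
    have "(\<Sum>k\<in>UNIV. \<i> * of_real (t * c k)) = \<i> * of_real (t * sum c UNIV)"
      by (simp add: sum_distrib_left)
    then show ?thesis by (simp add: b_def sum.distrib c(2))
  qed
  define Z where "Z t = P ** (diag_mat (\<lambda>k. exp (b t k)) + N) ** Q" for t
  have "charpoly_power (Z 0) (\<phi> (Z 0))"
  proof (rule charpoly_power_limit[OF \<phi>(1) _ _ countable_noninjective_imaginary_times[OF c(1), of a]])
    show "continuous_on {0..1} Z"
      unfolding Z_def b_def by (intro continuous_intros continuous_on_diag_mat)
    show "Z t \<in> S" for t
      using S[OF unitary_mat_1, of 1 "b t"] sum_b[of t] by (simp add: Z_def)
    show "charpoly_power (Z t) (\<phi> (Z t))"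
      if "t \<in> {0<..<1} - {t. \<not> inj (\<lambda>k. exp (a k + \<i> * of_real (t * c k)))}" for t
      unfolding Z_def
    proof (rule charpoly_power_distinct_exponentials[OF \<phi> PQ r N])
      show "inj (\<lambda>k. exp (b t k))" using that by (simp add: b_def)
      show "P ** (R ** (diag_mat (\<lambda>k. exp (e k)) + s *\<^sub>R N) ** adjoint_matrix R) ** Q \<in> S"
        if "unitary_matrix R" "s \<in> {0..1}" "sum e UNIV = sum (b t) UNIV" for R s e
        using S[OF that(1,2)] that(3) sum_b by metis
    qed
  qed
  moreover have "Z 0 = X" by (simp add: Z_def X_def b_def)
  ultimately show ?thesis by simp
qed

section \<open>The unitary group\<close>

text \<open>
  The arguments \<open>\<theta>\<close> lie in an interval of length less than \<open>2\<pi>\<close>. A tuple of arguments is called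
  \<open>cyclic\<close> if it lists points of the circle in the same cyclic order as \<open>\<theta>\<close>, without completing a
  turn. These tuples form a convex set. Besides \<open>\<theta>\<close> it contains the tuple \<open>\<beta>\<close> that assigns to every
  index the argument of its successor, increased by \<open>2\<pi>\<close> for the last index. The segment between them is
  the path of eigenvalues for the cyclic shift \<open>\<sigma>\<close>.
\<close>

lemma charpoly_power_distinct_unit_circle:
  fixes \<phi> :: "complex^'n^'n \<Rightarrow> complex^'m^'m" and \<theta> :: "'n \<Rightarrow> real"
  assumes \<phi>: "continuous_on {X. unitary_matrix X} \<phi>" "spectrum_shrinking_on {X. unitary_matrix X} \<phi>"
    and V: "unitary_matrix V" and inj\<theta>: "inj \<theta>" and near: "\<And>k l. \<theta> l < \<theta> k + 2 * pi"
  defines "X \<equiv> V ** diag_mat (\<lambda>k. exp (\<i> * of_real (\<theta> k))) ** adjoint_matrix V"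
  shows "charpoly_power X (\<phi> X)"
proof -
  note PQ = unitary_matrixD(2)[OF V]
  have unit: "unitary_matrix (V ** (R ** diag_mat (\<lambda>k. exp (\<i> * of_real (\<alpha> k))) ** adjoint_matrix R) ** adjoint_matrix V)"
    if "unitary_matrix R" for R and \<alpha> :: "'n \<Rightarrow> real"
    using V that by (intro unitary_matrix_mult unitary_matrix_adjoint) (simp_all add: unitary_diag_mat_iff)
  have unit1: "unitary_matrix (V ** diag_mat (\<lambda>k. exp (\<i> * of_real (\<alpha> k))) ** adjoint_matrix V)"
    for \<alpha> :: "'n \<Rightarrow> real"
    using V by (intro unitary_matrix_mult unitary_matrix_adjoint) (simp_all add: unitary_diag_mat_iff)
  define cyclic where "cyclic \<alpha> \<longleftrightarrow> (\<forall>k l. \<theta> k < \<theta> l \<longrightarrow> \<alpha> k < \<alpha> l \<and> \<alpha> l < \<alpha> k + 2 * pi)"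
    for \<alpha> :: "'n \<Rightarrow> real"
  have cyclic_inj: "inj (\<lambda>k. exp (\<i> * of_real (\<alpha> k)))" if "cyclic \<alpha>" for \<alpha>
  proof -
    have ne: "exp (\<i> * of_real (\<alpha> k)) \<noteq> exp (\<i> * of_real (\<alpha> l))" if "\<theta> k < \<theta> l" for k l
    proof
      assume "exp (\<i> * of_real (\<alpha> k)) = exp (\<i> * of_real (\<alpha> l))"
      then obtain n :: int where "\<i> * of_real (\<alpha> k) = \<i> * of_real (\<alpha> l) + of_int (2 * n) * of_real pi * \<i>"
        unfolding exp_eq by auto
      then have "Im (\<i> * of_real (\<alpha> k)) = Im (\<i> * of_real (\<alpha> l) + of_int (2 * n) * of_real pi * \<i>)"
        by (rule arg_cong)
      then have n: "\<alpha> l - \<alpha> k = - of_int n * (2 * pi)" by simp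
      moreover have "0 < \<alpha> l - \<alpha> k" "\<alpha> l - \<alpha> k < 2 * pi"
        using \<open>cyclic \<alpha>\<close> \<open>\<theta> k < \<theta> l\<close> unfolding cyclic_def by (auto simp: diff_less_eq add.commute)
      ultimately have "0 < - real_of_int n * (2 * pi)" "- real_of_int n * (2 * pi) < 1 * (2 * pi)" by simp_all
      then have "n < 0" "- (real_of_int n * (2 * pi)) < 2 * pi"
        by (simp_all add: mult_less_0_iff zero_less_mult_iff)
      moreover from \<open>n < 0\<close> have "real_of_int n * (2 * pi) \<le> - 1 * (2 * pi)"
        by (intro mult_right_mono) simp_all
      ultimately show False by linarith
    qed
    show ?thesis
      using ne inj\<theta> by (metis (mono_tags, lifting) injI injD linorder_neqE_linordered_idom)
  qed
  have cyclic\<theta>: "cyclic \<theta>" using near by (simp add: cyclic_def)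
  \<comment> \<open>\<open>f\<close> numbers the indices by increasing argument, from \<open>0\<close> to \<open>n - 1\<close>.\<close>
  define f where "f k = card {l. \<theta> l < \<theta> k}" for k
  have f_less: "f k < f l" if "\<theta> k < \<theta> l" for k l
  proof -
    have "{j. \<theta> j < \<theta> k} \<subset> {j. \<theta> j < \<theta> l}" using that by auto
    then show ?thesis unfolding f_def by (intro psubset_card_mono) simp_all
  qed
  have f_iff: "\<theta> k < \<theta> l \<longleftrightarrow> f k < f l" for k l
    using f_less[of k l] f_less[of l k] injD[OF inj\<theta>, of k l] by (metis less_asym less_linear)
  have inj_f: "inj f" using f_less inj\<theta> by (metis injD injI less_irrefl less_linear)
  have f_bound: "f k < CARD('n)" for k
    unfolding f_def by (intro psubset_card_mono) auto
  have "f ` UNIV = {..<CARD('n)}"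
    using f_bound by (intro card_subset_eq) (auto simp: card_image inj_f)
  define g where "g = inv f"
  have fg: "f (g j) = j" if "j < CARD('n)" for j
    using that \<open>f ` UNIV = {..<CARD('n)}\<close> unfolding g_def by (intro f_inv_into_f) auto
  have gf: "g (f k) = k" for k using inj_f by (simp add: g_def)
  define \<sigma> where "\<sigma> k = g (Suc (f k) mod CARD('n))" for k
  define \<beta> where "\<beta> k = \<theta> (\<sigma> k) + (if Suc (f k) = CARD('n) then 2 * pi else 0)" for k
  have f\<sigma>: "f (\<sigma> k) = Suc (f k) mod CARD('n)" for k by (simp add: \<sigma>_def fg)
  have f\<sigma>': "f (\<sigma> k) = (if Suc (f k) = CARD('n) then 0 else Suc (f k))" for k
    using f_bound[of k] by (auto simp: f\<sigma>)
  have "inj \<sigma>"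
  proof (rule injI)
    fix k l assume "\<sigma> k = \<sigma> l"
    then have "f (\<sigma> k) = f (\<sigma> l)" by simp
    then have "f k = f l" unfolding f\<sigma>' by (auto split: if_splits)
    then show "k = l" using inj_f by (simp add: inj_eq)
  qed
  then have \<sigma>: "bij \<sigma>" by (simp add: finite_UNIV_inj_surj bij_def)
  have cyclic\<beta>: "cyclic \<beta>"
    unfolding cyclic_def
  proof (intro allI impI)
    fix k l assume "\<theta> k < \<theta> l"
    then have kl: "f k < f l" by (simp add: f_iff)
    then have k: "f (\<sigma> k) = Suc (f k)" "\<beta> k = \<theta> (\<sigma> k)" using f_bound[of l] by (simp_all add: f\<sigma>' \<beta>_def)
    show "\<beta> k < \<beta> l \<and> \<beta> l < \<beta> k + 2 * pi"
    proof (cases "Suc (f l) = CARD('n)")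
      case True
      then have l: "f (\<sigma> l) = 0" "\<beta> l = \<theta> (\<sigma> l) + 2 * pi" by (simp_all add: f\<sigma>' \<beta>_def)
      then have "\<theta> (\<sigma> l) < \<theta> (\<sigma> k)" by (simp add: f_iff k)
      then show ?thesis using near[of "\<sigma> k" "\<sigma> l"] by (simp add: k l)
    next
      case False
      then have l: "f (\<sigma> l) = Suc (f l)" "\<beta> l = \<theta> (\<sigma> l)" by (simp_all add: f\<sigma>' \<beta>_def)
      then have "\<theta> (\<sigma> k) < \<theta> (\<sigma> l)" using kl by (simp add: f_iff k)
      then show ?thesis using near[of "\<sigma> l" "\<sigma> k"] by (simp add: k l)
    qed
  qed
  define \<alpha> where "\<alpha> t k = (1 - t) * \<beta> k + t * \<theta> k" for t k
  have cyclic\<alpha>: "cyclic (\<alpha> t)" if t: "t \<in> {0..1}" for t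
    unfolding cyclic_def
  proof (intro allI impI)
    fix k l assume kl: "\<theta> k < \<theta> l"
    have pos: "0 < (1 - t) * x + t * y" if "0 < x" "0 < y" for x y :: real
      using t that by (cases "t = 0") (auto intro: add_nonneg_pos)
    have "0 < (1 - t) * (\<beta> l - \<beta> k) + t * (\<theta> l - \<theta> k)"
      "0 < (1 - t) * (\<beta> k + 2 * pi - \<beta> l) + t * (\<theta> k + 2 * pi - \<theta> l)"
      using cyclic\<beta> cyclic\<theta> kl unfolding cyclic_def by (auto intro!: pos)
    then show "\<alpha> t k < \<alpha> t l \<and> \<alpha> t l < \<alpha> t k + 2 * pi"
      by (simp add: \<alpha>_def algebra_simps)
  qed
  have "spectrum (\<phi> X) \<subseteq> range (\<lambda>k. exp (\<i> * of_real (\<theta> k)))"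
    using \<phi>(2) unit1[of \<theta>] charpoly_similar_diag(2)[OF PQ, of "\<lambda>k. exp (\<i> * of_real (\<theta> k))"]
    unfolding spectrum_shrinking_on_def X_def by blast
  then obtain d where d: "charpoly (\<phi> X) = (\<Prod>k\<in>UNIV. [:- exp (\<i> * of_real (\<theta> k)), 1:] ^ d k)"
    by (rule charpoly_factors_over_spectrum_bound[OF cyclic_inj[OF cyclic\<theta>]])
  have "d \<circ> \<sigma> = d"
  proof (rule multiplicities_invariant_under_monodromy[OF \<phi> PQ \<sigma>,
        where \<mu> = "\<lambda>t k. exp (\<i> * of_real (\<alpha> t k))"])
    show "(\<lambda>k. exp (\<i> * of_real (\<alpha> 0 k))) = (\<lambda>k. exp (\<i> * of_real (\<alpha> 1 k))) \<circ> \<sigma>"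
    proof
      fix k
      have "exp (\<i> * (of_real (\<theta> (\<sigma> k)) + 2 * of_real pi)) = exp (\<i> * of_real (\<theta> (\<sigma> k)))"
        by (simp add: algebra_simps exp_add)
      then show "exp (\<i> * of_real (\<alpha> 0 k)) = ((\<lambda>k. exp (\<i> * of_real (\<alpha> 1 k))) \<circ> \<sigma>) k"
        by (simp add: \<alpha>_def \<beta>_def)
    qed
    show "continuous_on {0..1} (\<lambda>t. exp (\<i> * of_real (\<alpha> t k)))" for k
      unfolding \<alpha>_def by (intro continuous_intros)
    show "inj (\<lambda>k. exp (\<i> * of_real (\<alpha> t k)))" if "t \<in> {0..1}" for t
      by (rule cyclic_inj[OF cyclic\<alpha>[OF that]])
    show "charpoly (\<phi> (V ** diag_mat (\<lambda>k. exp (\<i> * of_real (\<alpha> 1 k))) ** adjoint_matrix V))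
        = (\<Prod>k\<in>UNIV. [:- exp (\<i> * of_real (\<alpha> 1 k)), 1:] ^ d k)"
      using d by (simp add: X_def \<alpha>_def)
  qed (use unit unit1 in simp_all)
  then have step: "d (\<sigma> k) = d k" for k by (metis comp_apply)
  have "d (g j) = d (g 0)" if "j < CARD('n)" for j
    using that
  proof (induction j)
    case (Suc j)
    then have "\<sigma> (g j) = g (Suc j)" by (simp add: \<sigma>_def fg)
    with step[of "g j"] Suc show ?case by simp
  qed simp
  then have "d k = d (g 0)" for k using f_bound[of k] gf[of k] by metis
  then have "d k = d l" for k l by metis
  with charpoly_similar_diag(1)[OF PQ] d show ?thesis
    unfolding X_def by (intro charpoly_powerI)
qed

text \<open>
  Principal arguments differ by less than \<open>2\<pi>\<close>, so the distinct case applies to small perturbations.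
\<close>

theorem charpoly_power_unitary:
  fixes \<phi> :: "complex^'n^'n \<Rightarrow> complex^'m^'m"
  assumes \<phi>: "continuous_on {X. unitary_matrix X} \<phi>" "spectrum_shrinking_on {X. unitary_matrix X} \<phi>"
    and X: "unitary_matrix X"
  shows "charpoly_power X (\<phi> X)"
proof -
  obtain V \<theta> where V: "unitary_matrix V"
      and X_eq: "X = V ** diag_mat (\<lambda>k. exp (\<i> * of_real (\<theta> k))) ** adjoint_matrix V"
    by (rule unitary_conj_diag_exp[OF X])
  obtain c :: "'n \<Rightarrow> real" where c: "inj c" "sum c UNIV = 0" by (rule ex_injective_sum_zero)
  define Z where "Z t = V ** diag_mat (\<lambda>k. exp (\<i> * of_real (\<theta> k) + \<i> * of_real (t * c k))) ** adjoint_matrix V" for t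
  have "charpoly_power (Z 0) (\<phi> (Z 0))"
  proof (rule charpoly_power_limit[OF \<phi>(1) _ _
        countable_noninjective_imaginary_times[OF c(1), of "\<lambda>k. \<i> * of_real (\<theta> k)"]])
    show "continuous_on {0..1} Z"
      unfolding Z_def by (intro continuous_intros continuous_on_diag_mat)
    show "Z t \<in> {X. unitary_matrix X}" for t
      unfolding Z_def mem_Collect_eq using V
      by (intro unitary_matrix_mult unitary_matrix_adjoint) (simp_all add: unitary_diag_mat_iff)
    show "charpoly_power (Z t) (\<phi> (Z t))"
      if t: "t \<in> {0<..<1} - {t. \<not> inj (\<lambda>k. exp (\<i> * of_real (\<theta> k) + \<i> * of_real (t * c k)))}" for t
    proof -
      define \<eta> where "\<eta> k = Arg (exp (\<i> * of_real (\<theta> k) + \<i> * of_real (t * c k)))" for k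
      have \<eta>: "exp (\<i> * of_real (\<eta> k)) = exp (\<i> * of_real (\<theta> k) + \<i> * of_real (t * c k))" for k
        unfolding \<eta>_def complex_norm_eq_1_exp_eq[symmetric] by (simp add: norm_exp_eq_Re)
      have "inj (\<lambda>k. exp (\<i> * of_real (\<eta> k)))" using t by (simp add: \<eta>)
      then have "inj \<eta>" by (auto simp: inj_def)
      moreover have "\<eta> l < \<eta> k + 2 * pi" for k l
        using Arg_bounded unfolding \<eta>_def by (smt (verit))
      ultimately show ?thesis
        using charpoly_power_distinct_unit_circle[OF \<phi> V, of \<eta>] by (simp add: \<eta> Z_def)
    qed
  qed
  moreover have "Z 0 = X" by (simp add: Z_def X_eq)
  ultimately show ?thesis by simp
qed

section \<open>The eight matrix spaces\<close>

lemma det_similar: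
  fixes P Q T :: "'a::comm_ring_1^'n^'n"
  assumes "P ** Q = mat 1"
  shows "det (P ** T ** Q) = det T"
proof -
  have "det P * det Q = 1" using assms by (metis det_I det_mul)
  moreover have "det (P ** T ** Q) = (det P * det Q) * det T" by (simp add: det_mul)
  ultimately show ?thesis by simp
qed

lemma det_exp_triangular:
  fixes N :: "complex^'n^'n" and r :: "'n \<Rightarrow> nat"
  assumes r: "inj r" and N: "\<And>i j. \<not> r i < r j \<Longrightarrow> N $ i $ j = 0"
  shows "det (diag_mat (\<lambda>k. exp (b k)) + s *\<^sub>R N) = exp (sum b UNIV)"
proof -
  have "det (diag_mat (\<lambda>k. exp (b k)) + s *\<^sub>R N) = (\<Prod>k\<in>UNIV. (diag_mat (\<lambda>k. exp (b k)) + s *\<^sub>R N) $ k $ k)"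
    by (rule det_triangular[OF r]) (use N in auto)
  also have "\<dots> = exp (sum b UNIV)"
    using N by (simp add: exp_sum)
  finally show ?thesis .
qed

text \<open>
  The loops through \<open>X\<close> have constant determinant, so one lemma serves the general and the special
  linear group; the variants for diagonalizable and normal matrices below are stated in the same way.
\<close>

lemma charpoly_power_same_det:
  fixes \<phi> :: "complex^'n^'n \<Rightarrow> complex^'m^'m" and X :: "complex^'n^'n"
  assumes \<phi>: "continuous_on S \<phi>" "spectrum_shrinking_on S \<phi>"
    and X: "det X \<noteq> 0" and S: "\<And>Y. det Y = det X \<Longrightarrow> Y \<in> S"
  shows "charpoly_power X (\<phi> X)"
proof -
  obtain V T and r :: "'n \<Rightarrow> nat" where V: "unitary_matrix V" and r: "inj r"
    and T: "\<And>i j. r j < r i \<Longrightarrow> T $ i $ j = 0" and X_eq: "X = V ** T ** adjoint_matrix V"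
    by (rule schur_triangularization) blast
  note PQ = unitary_matrixD(2)[OF V]
  have "det X = det T" unfolding X_eq by (rule det_similar[OF PQ])
  also have "\<dots> = (\<Prod>k\<in>UNIV. T $ k $ k)" by (rule det_triangular[OF r]) (rule T)
  finally have T0: "T $ k $ k \<noteq> 0" for k using X by auto
  define a where "a k = Ln (T $ k $ k)" for k
  define N where "N = T - diag_mat (\<lambda>k. T $ k $ k)"
  have N: "N $ i $ j = 0" if "\<not> r i < r j" for i j
  proof (cases "i = j")
    case False
    with that r have "r j < r i" by (metis injD linorder_neqE_nat)
    with T False show ?thesis by (simp add: N_def)
  qed (simp add: N_def)
  have T_eq: "T = diag_mat (\<lambda>k. exp (a k)) + N" by (simp add: a_def T0 N_def)
  have det_exp: "det (diag_mat (\<lambda>k. exp (b k)) + s *\<^sub>R N) = exp (sum b UNIV)" for b s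
    using r N by (rule det_exp_triangular)
  have detX: "det X = exp (sum a UNIV)"
    using det_exp[of a 1] \<open>det X = det T\<close> by (simp add: T_eq)
  have "charpoly_power (V ** (diag_mat (\<lambda>k. exp (a k)) + N) ** adjoint_matrix V)
      (\<phi> (V ** (diag_mat (\<lambda>k. exp (a k)) + N) ** adjoint_matrix V))"
  proof (rule charpoly_power_exponentials[OF \<phi> PQ r N])
    show "V ** (R ** (diag_mat (\<lambda>k. exp (b k)) + s *\<^sub>R N) ** adjoint_matrix R) ** adjoint_matrix V \<in> S"
      if "unitary_matrix R" "sum b UNIV = sum a UNIV" for R s b
      by (rule S) (simp only: det_similar[OF PQ] det_similar[OF unitary_matrixD(2)[OF that(1)]] det_exp that(2) detX)
  qed
  then show ?thesis by (simp add: X_eq T_eq)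
qed

text \<open>
  The common core for diagonalizable matrices, with \<open>P\<close> invertible, and normal ones, with \<open>P\<close> unitary.
\<close>

lemma charpoly_power_same_det_diagonal:
  fixes \<phi> :: "complex^'n^'n \<Rightarrow> complex^'m^'m" and P Q :: "complex^'n^'n"
  assumes \<phi>: "continuous_on S \<phi>" "spectrum_shrinking_on S \<phi>"
    and PQ: "P ** Q = mat 1" and d0: "det (P ** diag_mat d ** Q) \<noteq> 0"
    and S: "\<And>R e. unitary_matrix R \<Longrightarrow> det (P ** (R ** diag_mat e ** adjoint_matrix R) ** Q) = det (P ** diag_mat d ** Q) \<Longrightarrow>
        P ** (R ** diag_mat e ** adjoint_matrix R) ** Q \<in> S"
  shows "charpoly_power (P ** diag_mat d ** Q) (\<phi> (P ** diag_mat d ** Q))"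
proof -
  obtain r :: "'n \<Rightarrow> nat" where r: "inj r" by (rule ex_inj_nat)
  have det_eq: "det (P ** diag_mat d ** Q) = det (diag_mat d)"
    by (rule det_similar[OF PQ])
  moreover have "det (diag_mat d) = (\<Prod>k\<in>UNIV. d k)"
    using det_diagonal[of "diag_mat d"] by simp
  ultimately have "d k \<noteq> 0" for k using d0 by auto
  then have d_eq: "d = (\<lambda>k. exp (Ln (d k)))" by simp
  have N: "\<And>i j. \<not> r i < r j \<Longrightarrow> (0 :: complex^'n^'n) $ i $ j = 0" by simp
  have det_exp: "det (diag_mat (\<lambda>k. exp (b k)) :: complex^'n^'n) = exp (sum b UNIV)" for b
    using det_exp_triangular[OF r N, of b 1] by simp
  have det_d: "det (diag_mat d) = exp (\<Sum>k\<in>UNIV. Ln (d k))"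
    by (subst d_eq) (rule det_exp)
  have "charpoly_power (P ** (diag_mat (\<lambda>k. exp (Ln (d k))) + 0) ** Q)
      (\<phi> (P ** (diag_mat (\<lambda>k. exp (Ln (d k))) + 0) ** Q))"
  proof (rule charpoly_power_exponentials[OF \<phi> PQ r N])
    show "P ** (R ** (diag_mat (\<lambda>k. exp (b k)) + s *\<^sub>R 0) ** adjoint_matrix R) ** Q \<in> S"
      if "unitary_matrix R" "sum b UNIV = (\<Sum>k\<in>UNIV. Ln (d k))" for R s b
      using S[OF that(1), of "\<lambda>k. exp (b k)"]
      by (simp add: det_similar[OF PQ] det_similar[OF unitary_matrixD(2)[OF that(1)]] det_exp that(2) det_d)
  qed
  then show ?thesis using d_eq by simp
qed

lemma matrix_inv:
  fixes A :: "'a::semiring_1^'n^'m"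
  assumes "invertible A"
  shows "A ** matrix_inv A = mat 1" "matrix_inv A ** A = mat 1"
  using someI_ex[OF assms[unfolded invertible_def]] unfolding matrix_inv_def by blast+

lemma diagonalizableI:
  fixes P Q :: "complex^'n^'n"
  assumes "P ** Q = mat 1"
  shows "diagonalizable (P ** diag_mat d ** Q)"
proof -
  have QP: "Q ** P = mat 1" using assms by (simp add: matrix_left_right_inverse)
  with assms have inv: "invertible P" by (auto simp: invertible_def)
  have "matrix_inv P = matrix_inv P ** P ** Q" using assms by (simp add: matrix_mul_assoc[symmetric])
  also have "\<dots> = Q" by (simp add: matrix_inv(2)[OF inv])
  finally have "matrix_inv P = Q" .
  moreover have "diagonal_matrix (diag_mat d :: complex^'n^'n)" by (simp add: diagonal_matrix_def)
  ultimately show ?thesis using inv unfolding diagonalizable_def by metis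
qed

lemma diagonalizableE:
  fixes X :: "complex^'n^'n"
  assumes "diagonalizable X"
  obtains P Q :: "complex^'n^'n" and d where "P ** Q = mat 1" "X = P ** diag_mat d ** Q"
proof -
  obtain P D :: "complex^'n^'n" where P: "invertible P" and D: "diagonal_matrix D"
      and X: "X = P ** D ** matrix_inv P"
    using assms unfolding diagonalizable_def by blast
  have "D = diag_mat (\<lambda>k. D $ k $ k)" using D by (simp add: diagonal_matrix_def vec_eq_iff)
  with X matrix_inv(1)[OF P] that show ?thesis by metis
qed

lemma normal_matrix_unitary_conj:
  assumes "unitary_matrix V"
  shows "normal_matrix (V ** diag_mat d ** adjoint_matrix V)"
proof -
  have adj: "adjoint_matrix (V ** diag_mat d ** adjoint_matrix V)
      = V ** diag_mat (\<lambda>k. cnj (d k)) ** adjoint_matrix V"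
    by (simp add: adjoint_matrix_mult adjoint_diag_mat matrix_mul_assoc)
  have prod: "(V ** A ** adjoint_matrix V) ** (V ** B ** adjoint_matrix V) = V ** (A ** B) ** adjoint_matrix V"
    for A B
    using unitary_matrixD(1)[OF assms] by (simp add: matrix_mul_assoc cancel_mid)
  show ?thesis
    unfolding normal_matrix_def adj prod diag_mat_mult by (simp add: mult.commute)
qed

lemma charpoly_power_same_det_diagonalizable:
  fixes \<phi> :: "complex^'n^'n \<Rightarrow> complex^'m^'m" and X :: "complex^'n^'n"
  assumes \<phi>: "continuous_on S \<phi>" "spectrum_shrinking_on S \<phi>"
    and X: "diagonalizable X" "det X \<noteq> 0"
    and S: "\<And>Y. diagonalizable Y \<Longrightarrow> det Y = det X \<Longrightarrow> Y \<in> S"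
  shows "charpoly_power X (\<phi> X)"
proof -
  obtain P Q :: "complex^'n^'n" and d where PQ: "P ** Q = mat 1" and X_eq: "X = P ** diag_mat d ** Q"
    using X(1) by (rule diagonalizableE)
  show ?thesis
    unfolding X_eq
  proof (rule charpoly_power_same_det_diagonal[OF \<phi> PQ])
    show "P ** (R ** diag_mat e ** adjoint_matrix R) ** Q \<in> S"
      if R: "unitary_matrix R" and "det (P ** (R ** diag_mat e ** adjoint_matrix R) ** Q) = det (P ** diag_mat d ** Q)"
      for R e
    proof (rule S)
      have "(P ** R) ** (adjoint_matrix R ** Q) = mat 1"
        using unitary_matrixD(2)[OF R] PQ by (simp add: cancel_mid)
      from diagonalizableI[OF this, of e] show "diagonalizable (P ** (R ** diag_mat e ** adjoint_matrix R) ** Q)"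
        by (simp add: matrix_mul_assoc)
    qed (use that X_eq in simp)
  qed (use X(2) X_eq in simp)
qed

lemma charpoly_power_same_det_normal:
  fixes \<phi> :: "complex^'n^'n \<Rightarrow> complex^'m^'m" and X :: "complex^'n^'n"
  assumes \<phi>: "continuous_on S \<phi>" "spectrum_shrinking_on S \<phi>"
    and X: "normal_matrix X" "det X \<noteq> 0"
    and S: "\<And>Y. normal_matrix Y \<Longrightarrow> det Y = det X \<Longrightarrow> Y \<in> S"
  shows "charpoly_power X (\<phi> X)"
proof -
  obtain V d where V: "unitary_matrix V" and X_eq: "X = V ** diag_mat d ** adjoint_matrix V"
    using X(1) by (rule normal_imp_unitarily_diagonalizable)
  show ?thesis
    unfolding X_eq
  proof (rule charpoly_power_same_det_diagonal[OF \<phi> unitary_matrixD(2)[OF V]])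
    show "V ** (R ** diag_mat e ** adjoint_matrix R) ** adjoint_matrix V \<in> S"
      if R: "unitary_matrix R"
        and "det (V ** (R ** diag_mat e ** adjoint_matrix R) ** adjoint_matrix V) = det (V ** diag_mat d ** adjoint_matrix V)"
      for R e
    proof (rule S)
      from normal_matrix_unitary_conj[OF unitary_matrix_mult[OF V R], of e]
      show "normal_matrix (V ** (R ** diag_mat e ** adjoint_matrix R) ** adjoint_matrix V)"
        by (simp add: matrix_mul_assoc adjoint_matrix_mult)
    qed (use that X_eq in simp)
  qed (use X(2) X_eq in simp)
qed

lemma countable_singular_shifts:
  fixes X :: "complex^'n^'n"
  shows "countable {t::real. det (X + mat (of_real t)) = 0}"
proof -
  have "X + mat (of_real t) = (\<chi> i j. (- 1) * (mat (- of_real t) - X) $ i $ j)" for t :: real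
    by (simp add: vec_eq_iff mat_def)
  then have eq: "det (X + mat (of_real t)) = (- 1) ^ CARD('n) * poly (charpoly X) (- of_real t)" for t :: real
    by (simp only: det_scale poly_charpoly)
  have "charpoly X \<noteq> 0" using lead_coeff_charpoly[of X] by auto
  then have "countable ((\<lambda>x. - Re x) ` {x. poly (charpoly X) x = 0})"
    by (intro countable_image countable_finite poly_roots_finite)
  moreover have "{t::real. det (X + mat (of_real t)) = 0} \<subseteq> (\<lambda>x. - Re x) ` {x. poly (charpoly X) x = 0}"
    by (auto simp: eq intro!: image_eqI[where x = "- of_real _"])
  ultimately show ?thesis by (rule countable_subset[rotated])
qed

text \<open>
  Spaces that contain singular matrices are handled through the invertible matrices \<open>X + t I\<close>.
\<close>

lemma charpoly_power_shift:
  fixes X :: "complex^'n^'n"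
  assumes \<phi>: "continuous_on S \<phi>" and S: "\<And>t. X + mat (of_real t) \<in> S"
    and pw: "\<And>t. det (X + mat (of_real t)) \<noteq> 0 \<Longrightarrow>
      charpoly_power (X + mat (of_real t)) (\<phi> (X + mat (of_real t)))"
  shows "charpoly_power X (\<phi> X)"
proof -
  have "continuous_on {0..1} (\<lambda>t::real. if i = j then complex_of_real t else 0)" for i j :: 'n
    by (cases "i = j") (auto intro!: continuous_intros)
  then have "continuous_on {0..1} (\<lambda>t::real. X + mat (of_real t))"
    unfolding mat_def by (intro continuous_intros)
  from charpoly_power_limit[OF \<phi> this S countable_singular_shifts[of X]] pw
  show ?thesis by (simp add: mat_def zero_vec_def[symmetric])
qed

lemma matrix_mult_add_rdistrib:
  fixes A B :: "'a::semiring_1^'n^'m"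
  shows "(A + B) ** C = A ** C + B ** C"
  by (simp add: vec_eq_iff matrix_matrix_mult_def algebra_simps sum.distrib)

theorem charpoly_power_on_matrix_spaces:
  fixes \<phi> :: "complex^'n^'n \<Rightarrow> complex^'m^'m"
  assumes "S \<in> matrix_spaces" and \<phi>: "continuous_on S \<phi>" "spectrum_shrinking_on S \<phi>"
    and X: "X \<in> S"
  shows "charpoly_power X (\<phi> X)"
proof -
  have inv: "invertible Y \<longleftrightarrow> det Y \<noteq> 0" for Y :: "complex^'n^'n" by (rule invertible_det_nz)
  consider "S = UNIV" | "S = {X. diagonalizable X}" | "S = {X. invertible X}"
    | "S = {X. diagonalizable X \<and> invertible X}" | "S = {X. det X = 1}"
    | "S = {X. diagonalizable X \<and> det X = 1}" | "S = {X. unitary_matrix X}" | "S = {X. normal_matrix X}"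
    using assms(1) unfolding matrix_spaces_def by blast
  then show ?thesis
  proof cases
    case 1
    show ?thesis
      by (rule charpoly_power_shift[OF \<phi>(1)]) (simp_all add: 1 charpoly_power_same_det[OF \<phi>])
  next
    case 2
    obtain P Q :: "complex^'n^'n" and d where PQ: "P ** Q = mat 1" and X_eq: "X = P ** diag_mat d ** Q"
      using X by (auto simp: 2 elim: diagonalizableE)
    have "P ** (D + mat x) ** Q = P ** D ** Q + mat x" for D x
    proof -
      have "P ** mat x ** Q = mat x ** (P ** Q)"
        by (simp only: mat_comm[of x P, symmetric] matrix_mul_assoc)
      then show ?thesis by (simp add: matrix_add_ldistrib matrix_mult_add_rdistrib PQ)
    qed
    moreover have "diag_mat d + mat x = (diag_mat (\<lambda>k. d k + x) :: complex^'n^'n)" for x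
      by (simp add: vec_eq_iff mat_def)
    ultimately have "X + mat x = P ** diag_mat (\<lambda>k. d k + x) ** Q" for x
      by (metis X_eq)
    then have diag: "diagonalizable (X + mat x)" for x using diagonalizableI[OF PQ] by metis
    show ?thesis
      by (rule charpoly_power_shift[OF \<phi>(1)])
        (simp_all add: 2 diag charpoly_power_same_det_diagonalizable[OF \<phi>])
  next
    case 3
    show ?thesis
      by (rule charpoly_power_same_det[OF \<phi>]) (use X in \<open>simp_all add: 3 inv\<close>)
  next
    case 4
    show ?thesis
      by (rule charpoly_power_same_det_diagonalizable[OF \<phi>]) (use X in \<open>simp_all add: 4 inv\<close>)
  next
    case 5
    show ?thesis
      by (rule charpoly_power_same_det[OF \<phi>]) (use X in \<open>simp_all add: 5\<close>)
  next
    case 6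
    show ?thesis
      by (rule charpoly_power_same_det_diagonalizable[OF \<phi>]) (use X in \<open>simp_all add: 6\<close>)
  next
    case 7
    show ?thesis
      using charpoly_power_unitary \<phi> X unfolding 7 by blast
  next
    case 8
    have norm: "normal_matrix (X + mat (of_real t))" for t :: real
    proof -
      have "adjoint_matrix (X + mat (of_real t)) = adjoint_matrix X + mat (of_real t)"
        by (simp add: vec_eq_iff mat_def)
      moreover have "X ** adjoint_matrix X = adjoint_matrix X ** X"
        using X by (simp add: 8 normal_matrix_def)
      ultimately show ?thesis
        by (simp add: normal_matrix_def matrix_add_ldistrib matrix_mult_add_rdistrib
            mat_comm[of "of_real t" X] mat_comm[of "of_real t" "adjoint_matrix X"] ac_simps)
    qed
    show ?thesis
      by (rule charpoly_power_shift[OF \<phi>(1)])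
        (simp_all add: 8 norm charpoly_power_same_det_normal[OF \<phi>])
  qed
qed

lemma mat_1_in_matrix_spaces:
  assumes "S \<in> matrix_spaces"
  shows "mat 1 \<in> S"
proof -
  have "diagonalizable (mat 1 :: complex^'n^'n)"
    using diagonalizableI[of "mat 1" "mat 1" "\<lambda>_. 1"] by (simp add: diag_mat_one)
  moreover have "invertible (mat 1 :: complex^'n^'n)" by (simp add: invertible_det_nz)
  ultimately show ?thesis
    using assms unitary_mat_1 unitary_imp_normal[OF unitary_mat_1] by (auto simp: matrix_spaces_def)
qed

text \<open>
  The map puts \<open>e = m / n\<close> copies of \<open>X\<close> along the diagonal; the bijection \<open>f\<close> sends an index to its
  position inside a block and the number of the block. An eigenvector of the block matrix restricts to
  one of \<open>X\<close> on any block where it does not vanish.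
\<close>

lemma ex_spectrum_shrinking_if_dvd:
  assumes "CARD('n) dvd CARD('m)"
  shows "\<exists>\<phi> :: complex^'n^'n \<Rightarrow> complex^'m^'m. continuous_on S \<phi> \<and> spectrum_shrinking_on S \<phi>"
proof -
  obtain e where e: "CARD('m) = CARD('n) * e" using assms by (elim dvdE)
  have "card (UNIV :: 'm set) = card ((UNIV :: 'n set) \<times> {..<e})" by (simp add: card_cartesian_product e)
  then obtain f :: "'m \<Rightarrow> 'n \<times> nat" where f: "bij_betw f UNIV (UNIV \<times> {..<e})"
    using finite_same_card_bij[of "UNIV :: 'm set" "(UNIV :: 'n set) \<times> {..<e}"] by auto
  define \<phi> :: "complex^'n^'n \<Rightarrow> complex^'m^'m" where
    "\<phi> X = (\<chi> i j. if snd (f i) = snd (f j) then X $ fst (f i) $ fst (f j) else 0)" for X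
  have "continuous_on S (\<lambda>X :: complex^'n^'n. if snd (f i) = snd (f j) then X $ fst (f i) $ fst (f j) else 0)" for i j
    by (cases "snd (f i) = snd (f j)") (auto intro!: continuous_intros)
  then have "continuous_on S \<phi>" unfolding \<phi>_def by (intro continuous_on_vec_lambda)
  moreover have "spectrum (\<phi> X) \<subseteq> spectrum X" for X
  proof
    fix c assume "c \<in> spectrum (\<phi> X)"
    then obtain v where v: "v \<noteq> 0" "\<phi> X *v v = c *s v" by (auto simp: spectrum_def)
    then obtain i0 where i0: "v $ i0 \<noteq> 0" by (auto simp: vec_eq_iff)
    define b where "b = snd (f i0)"
    have b: "b < e" using bij_betwE[OF f] by (auto simp: b_def mem_Times_iff)
    define h where "h k = inv_into UNIV f (k, b)" for k
    have fh: "f (h k) = (k, b)" for k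
      using f b unfolding h_def by (intro bij_betw_inv_into_right) auto
    have hf: "h (fst (f i)) = i" if "snd (f i) = b" for i
      using f that unfolding h_def by (metis UNIV_I bij_betw_inv_into_left prod.collapse)
    define w :: "complex^'n" where "w = (\<chi> k. v $ h k)"
    have "w $ fst (f i0) = v $ i0" by (simp add: w_def hf b_def)
    with i0 have "w \<noteq> 0" by auto
    moreover have "X *v w = c *s w"
    proof -
      have "(X *v w) $ k = (c *s w) $ k" for k
      proof -
        have "(\<phi> X *v v) $ h k = (\<Sum>j\<in>UNIV. (if b = snd (f j) then X $ k $ fst (f j) else 0) * v $ j)"
          by (simp add: matrix_vector_mult_def \<phi>_def fh cong: if_cong)
        also have "\<dots> = (\<Sum>j\<in>{j. snd (f j) = b}. X $ k $ fst (f j) * v $ j)"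
          by (intro sum.mono_neutral_cong_right) auto
        also have "\<dots> = (\<Sum>l\<in>UNIV. X $ k $ l * v $ h l)"
          by (rule sum.reindex_bij_witness[of _ h "\<lambda>j. fst (f j)"]) (auto simp: fh hf)
        also have "\<dots> = (X *v w) $ k" by (simp add: matrix_vector_mult_def w_def)
        finally show ?thesis using v(2) by (simp add: w_def)
      qed
      then show ?thesis by (simp add: vec_eq_iff)
    qed
    ultimately show "c \<in> spectrum X" by (auto simp: spectrum_def)
  qed
  ultimately show ?thesis unfolding spectrum_shrinking_on_def by blast
qed

theorem theorem0p1:
  fixes S :: "(complex^'n^'n) set"
  assumes "S \<in> matrix_spaces"
  shows "((\<exists>\<phi> :: complex^'n^'n \<Rightarrow> complex^'m^'m.
             continuous_on S \<phi> \<and> spectrum_shrinking_on S \<phi>) \<longleftrightarrow> CARD('n) dvd CARD('m)) \<and>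
         (CARD('n) dvd CARD('m) \<longrightarrow>
           (\<forall>\<phi> :: complex^'n^'n \<Rightarrow> complex^'m^'m.
             continuous_on S \<phi> \<and> spectrum_shrinking_on S \<phi> \<longrightarrow>
             (\<forall>X\<in>S. charpoly (\<phi> X) = charpoly X ^ (CARD('m) div CARD('n)))))"
  using ex_spectrum_shrinking_if_dvd[where 'n = 'n and 'm = 'm, of S] mat_1_in_matrix_spaces[OF assms]
    charpoly_power_on_matrix_spaces[OF assms]
  unfolding charpoly_power_def by blast

end
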